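(* Let $G$ be a simple plane triangulation. Then $\mathrm{AT}(G_{vf})\leqslant 6$.
   Context: A plane triangulation is a simple connected plane graph all of whose faces are bounded by 3-cycles. Let $V,F$ be the vertex and face sets of $G$. The graph $G_{vf}$ is the simple graph with vertex set $V\cup F$ in which: two vertices of $G$ are adjacent iff adjacent in $G$; two faces are adjacent iff they share an edge of $G$; a vertex $v$ and a face $f$ are adjacent iff $v$ lies on the boundary of $f$. For a finite simple graph $H$ with vertex set $\{v_1,\dots,v_N\}$, the graph polynomial is $P_H=\prod_{v_iv_j\in E(H)}(v_i-v_j)\in\mathbb{R}[v_1,\dots,v_N]$ (one factor per edge, with a fixed choice of sign). The Alon–Tarsi number $\mathrm{AT}(H)$ is the least integer $k$ such that $P_H$ contains a monomial with nonzero coefficient in which every variable has degree at most $k-1$. *)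

theory Defs
  imports "HOL-Analysis.Analysis" "HOL-Library.Poly_Mapping"
begin

section \<open>Plane graphs and plane triangulations\<close>

text \<open>
  The plane is the type \<^typ>\<open>complex\<close>. A plane graph is a drawing: a finite set \<open>V\<close> of points and a
  finite set \<open>E\<close> of edges, each edge being (as a point set) a simple arc. The only points of \<open>V\<close>
  on an edge are its two ends, so \<open>e \<inter> V\<close> is the set of ends of \<open>e\<close>. Loops are excluded because an
  \<^const>\<open>arc\<close> is injective on the closed unit interval, parallel edges by the last condition.
\<close>

definition simple_plane_graph :: "complex set \<Rightarrow> complex set set \<Rightarrow> bool" where
  "simple_plane_graph V E \<longleftrightarrow>
     finite V \<and> finite E \<and>
     (\<forall>e\<in>E. \<exists>g. arc g \<and> path_image g = e \<and> e \<inter> V = {pathstart g, pathfinish g}) \<and>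
     (\<forall>e\<in>E. \<forall>e'\<in>E. e \<noteq> e' \<longrightarrow> e \<inter> e' \<subseteq> V) \<and>
     (\<forall>e\<in>E. \<forall>e'\<in>E. e \<noteq> e' \<longrightarrow> e \<inter> V \<noteq> e' \<inter> V)"

definition plane_adj :: "complex set \<Rightarrow> complex set set \<Rightarrow> complex \<Rightarrow> complex \<Rightarrow> bool" where
  "plane_adj V E u v \<longleftrightarrow> u \<noteq> v \<and> (\<exists>e\<in>E. e \<inter> V = {u, v})"

definition plane_connected :: "complex set \<Rightarrow> complex set set \<Rightarrow> bool" where
  "plane_connected V E \<longleftrightarrow> V \<noteq> {} \<and> (\<forall>u\<in>V. \<forall>v\<in>V. (plane_adj V E)\<^sup>*\<^sup>* u v)"

text \<open>The unbounded face is one of the faces.\<close>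

definition plane_faces :: "complex set \<Rightarrow> complex set set \<Rightarrow> complex set set" where
  "plane_faces V E = components (- (V \<union> \<Union>E))"

definition bounded_by_3_cycle :: "complex set \<Rightarrow> complex set set \<Rightarrow> complex set \<Rightarrow> bool" where
  "bounded_by_3_cycle V E f \<longleftrightarrow>
     (\<exists>a b c. \<exists>e\<^sub>1\<in>E. \<exists>e\<^sub>2\<in>E. \<exists>e\<^sub>3\<in>E. a \<noteq> b \<and> b \<noteq> c \<and> a \<noteq> c \<and>
        e\<^sub>1 \<inter> V = {a, b} \<and> e\<^sub>2 \<inter> V = {b, c} \<and> e\<^sub>3 \<inter> V = {a, c} \<and>
        frontier f = e\<^sub>1 \<union> e\<^sub>2 \<union> e\<^sub>3)"

definition plane_triangulation :: "complex set \<Rightarrow> complex set set \<Rightarrow> bool" where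
  "plane_triangulation V E \<longleftrightarrow>
     simple_plane_graph V E \<and> plane_connected V E \<and>
     (\<forall>f\<in>plane_faces V E. bounded_by_3_cycle V E f)"


section \<open>The vertex-face graph\<close>

text \<open>
  An abstract simple graph is given by its vertex set and a symmetric, irreflexive adjacency
  relation, of which only the restriction to the vertex set matters.
\<close>

definition vf_verts :: "complex set \<Rightarrow> complex set set \<Rightarrow> (complex + complex set) set" where
  "vf_verts V E = V <+> plane_faces V E"

fun vf_adj :: "complex set \<Rightarrow> complex set set \<Rightarrow>
    complex + complex set \<Rightarrow> complex + complex set \<Rightarrow> bool" where
  "vf_adj V E (Inl u) (Inl v) \<longleftrightarrow> plane_adj V E u v"
| "vf_adj V E (Inr f) (Inr g) \<longleftrightarrow> f \<noteq> g \<and> (\<exists>e\<in>E. e \<subseteq> frontier f \<and> e \<subseteq> frontier g)"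
| "vf_adj V E (Inl v) (Inr f) \<longleftrightarrow> v \<in> frontier f"
| "vf_adj V E (Inr f) (Inl v) \<longleftrightarrow> v \<in> frontier f"

lemma vf_adj_sym: "vf_adj V E x y \<Longrightarrow> vf_adj V E y x"
  by (cases x; cases y) (auto simp: plane_adj_def insert_commute)

lemma vf_adj_irrefl: "\<not> vf_adj V E x x"
  by (cases x) (auto simp: plane_adj_def)


section \<open>Graph polynomial and Alon--Tarsi number\<close>

text \<open>
  Real polynomials in variables indexed by \<^typ>\<open>'a\<close>: finitely supported maps from monomials
  (finitely supported exponent functions) to coefficients, with convolution as product.
\<close>

type_synonym 'a rpoly = "('a \<Rightarrow>\<^sub>0 nat) \<Rightarrow>\<^sub>0 real"

definition Var :: "'a \<Rightarrow> 'a rpoly" where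
  "Var v = Poly_Mapping.single (Poly_Mapping.single v 1) 1"

text \<open>A choice of signs lists each edge once, as an ordered pair.\<close>

definition sign_choice :: "'a set \<Rightarrow> ('a \<Rightarrow> 'a \<Rightarrow> bool) \<Rightarrow> ('a \<times> 'a) set \<Rightarrow> bool" where
  "sign_choice W adj D \<longleftrightarrow>
     D \<subseteq> {(u, v). u \<in> W \<and> v \<in> W \<and> adj u v} \<and>
     (\<forall>u\<in>W. \<forall>v\<in>W. adj u v \<longrightarrow> ((u, v) \<in> D) \<noteq> ((v, u) \<in> D))"

definition graph_poly_wrt :: "('a \<times> 'a) set \<Rightarrow> 'a rpoly" where
  "graph_poly_wrt D = (\<Prod>(u, v)\<in>D. Var u - Var v)"

definition graph_poly :: "'a set \<Rightarrow> ('a \<Rightarrow> 'a \<Rightarrow> bool) \<Rightarrow> 'a rpoly" where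
  "graph_poly W adj = graph_poly_wrt (SOME D. sign_choice W adj D)"

text \<open>Degree at most \<open>k - 1\<close> is written as degree \<open>< k\<close>, avoiding truncated subtraction.\<close>

definition alon_tarsi :: "'a set \<Rightarrow> ('a \<Rightarrow> 'a \<Rightarrow> bool) \<Rightarrow> nat" where
  "alon_tarsi W adj =
     (LEAST k. \<exists>m. Poly_Mapping.lookup (graph_poly W adj) m \<noteq> 0 \<and>
                   (\<forall>v\<in>W. Poly_Mapping.lookup m v < k))"

text \<open>
  A choice of signs exists for every simple graph, and for a finite graph any two choices give the
  same polynomial up to sign, hence the same monomials.
\<close>

lemma sign_choice_exists:
  assumes "\<And>x y. adj x y \<Longrightarrow> adj y x" and "\<And>x. \<not> adj x x"
  shows "\<exists>D. sign_choice W adj D"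
proof -
  obtain r :: "('a \<times> 'a) set" where r: "well_order_on UNIV r"
    using well_order_on by blast
  have "antisym r" "total r"
    using r by (auto simp: well_order_on_def linear_order_on_def partial_order_on_def)
  then have "sign_choice W adj {(u, v). u \<in> W \<and> v \<in> W \<and> adj u v \<and> (u, v) \<in> r}"
    using assms unfolding sign_choice_def antisym_def total_on_def by auto metis+
  then show ?thesis by blast
qed

lemma graph_poly_wrt_unique_up_to_sign:
  assumes "finite W" and sym: "\<And>x y. adj x y \<Longrightarrow> adj y x"
    and D: "sign_choice W adj D" and D': "sign_choice W adj D'"
  shows "graph_poly_wrt D' = graph_poly_wrt D \<or> graph_poly_wrt D' = - graph_poly_wrt D"
proof -
  define s where "s = (\<lambda>p. if p \<in> D' then p else prod.swap p)"
  define f :: "'a \<times> 'a \<Rightarrow> 'a rpoly" where "f = (\<lambda>(u, v). Var u - Var v)"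
  have "D \<subseteq> W \<times> W" using D by (auto simp: sign_choice_def)
  then have fin: "finite D" using \<open>finite W\<close> by (meson finite_SigmaI finite_subset)
  have "inj_on s D"
    using D D' unfolding inj_on_def s_def sign_choice_def by (auto split: if_splits)
  moreover have "s ` D \<subseteq> D'"
    using D D' unfolding s_def sign_choice_def by auto
  moreover have "D' \<subseteq> s ` D"
  proof
    fix p assume p: "p \<in> D'"
    obtain u v where uv: "p = (u, v)" by fastforce
    have *: "u \<in> W" "v \<in> W" "adj u v" "(v, u) \<notin> D'"
      using p uv D' by (auto simp: sign_choice_def)
    show "p \<in> s ` D"
    proof (cases "(u, v) \<in> D")
      case True
      then show ?thesis using p uv by (force simp: s_def)
    next
      case False
      then have "(v, u) \<in> D" using * D by (auto simp: sign_choice_def)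
      moreover have "s (v, u) = p" using * uv by (simp add: s_def)
      ultimately show ?thesis by force
    qed
  qed
  ultimately have "bij_betw s D D'" by (auto simp: bij_betw_def)
  then have "prod f D' = (\<Prod>p\<in>D. f (s p))"
    by (simp add: prod.reindex_bij_betw)
  moreover have "(\<Prod>p\<in>D. f (s p)) = prod f D \<or> (\<Prod>p\<in>D. f (s p)) = - prod f D"
    using fin
  proof (induction D)
    case empty
    then show ?case by simp
  next
    case (insert p A)
    have "f (s p) = f p \<or> f (s p) = - f p"
      by (cases p) (simp add: f_def s_def)
    then show ?case using insert by auto
  qed
  ultimately show ?thesis by (simp add: graph_poly_wrt_def f_def)
qed

end

theory Submission
  imports Defs "HOL-Complex_Analysis.Winding_Numbers"
begin

text \<open>
  Exponents at most 5 are allowed. Order the variables; when a variable is added, extract its exponent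
  0, so that each factor joining it to an earlier vertex contributes the earlier one. A final exponent
  is thus the starting exponent plus the number of later neighbours. Faces come first, vertices last.
  Each vertex of \<open>G\<close> then only sees later vertices of \<open>G\<close>, and 5-degeneracy of planar graphs suffices.
  A face has at most 6 neighbours (3 vertices, 3 faces), so it suffices that it is preceded by one of
  them. Only a starting block needs care: a face with at most 2 dual neighbours, or, if the dual is
  cubic, an even cycle with at most one chord, whose edge product has a nonzero coefficient at the
  monomial of all cycle variables (times one end of the chord). A shortest even cycle of a cubic graph
  has this form unless the graph contains \<open>K\<^sub>4\<close>; in that case \<open>G = K\<^sub>4\<close> and an even cycle
  through two vertices and two faces serves instead.

  For 5-degeneracy, adding an edge that closes a cycle splits a class of faces, by the Jordan curve
  theorem. This bounds the number of classes from below, and each class has at least three boundary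
  edges. That every edge lies on exactly two faces follows from the theta curve theorem.
\<close>

section \<open>Theta curves\<close>

text \<open>Vertices come after faces, so a face of the starting block keeps three later neighbours
  in \<open>V\<close>; its exponent in the block plus its later dual neighbours may then total only
  2. A single face with three dual neighbours fails. An odd cycle fails too, because the coefficient
  at the product of its variables is 1 - 1 = 0. On an even cycle this coefficient is 2, and a
  chordless cycle leaves each face with 1 + 1 + 3 = 5. A chord end has no later dual neighbour left,
  so it may carry exponent 2. If the dual is K4, no block of faces works: its polynomial is a
  Vandermonde determinant, each monomial of which has an exponent 3, and 3 + 3 = 6. Faces of
  subgraphs are never formed. Classes of faces of G, linked across the edges missing from the
  subgraph, stand for them, so that topology is applied to G alone and the count rests on an
  inequality version of Euler's formula.\<close>

lemma interior_arc_empty: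
  fixes g :: "real \<Rightarrow> complex"
  assumes "arc g"
  shows "interior (path_image g) = {}"
proof (rule ccontr)
  assume ne: "interior (path_image g) \<noteq> {}"
  have cont: "continuous_on {0..1} g" and inj: "inj_on g {0..1}"
    using assms by (auto simp: arc_def path_def)
  have "infinite (interior (path_image g))"
    using ne by (metis finite_imp_not_open open_interior)
  then have "\<not> interior (path_image g) \<subseteq> {g 0, g 1}"
    by (meson finite.emptyI finite.insertI finite_subset)
  then obtain p where p: "p \<in> interior (path_image g)" "p \<noteq> g 0" "p \<noteq> g 1" by blast
  then obtain t where t: "p = g t" "0 < t" "t < 1"
    using interior_subset unfolding path_image_def
    by (smt (verit, best) atLeastAtMost_iff image_iff subsetD)
  obtain r where r: "r > 0" "ball p r \<subseteq> path_image g"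
    using p(1) by (auto simp: mem_interior)
  have conn: "connected (ball p r - {p})"
    by (rule connected_punctured_ball) auto
  \<comment> \<open>An inner point \<open>p\<close> cuts the arc into two closed pieces that meet
    only in \<open>p\<close>. Both reach into the punctured disc around \<open>p\<close>, which they
    cover although it is connected.\<close>
  define L where "L = g ` {0..t}"
  define R where "R = g ` {t..1}"
  have cL: "closed L" "closed R"
    unfolding L_def R_def using t
    by (auto intro!: compact_imp_closed compact_continuous_image continuous_on_subset[OF cont])
  have cov: "ball p r - {p} \<subseteq> L \<union> R"
  proof
    fix x assume "x \<in> ball p r - {p}"
    then obtain s where "x = g s" "0 \<le> s" "s \<le> 1" using r(2) by (auto simp: path_image_def)
    then show "x \<in> L \<union> R" by (cases "s \<le> t") (auto simp: L_def R_def)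
  qed
  have LR: "L \<inter> R \<subseteq> {p}"
  proof
    fix x assume "x \<in> L \<inter> R"
    then obtain s s' where s: "x = g s" "0 \<le> s" "s \<le> t" "x = g s'" "t \<le> s'" "s' \<le> 1"
      unfolding L_def R_def by (elim IntE imageE) auto
    then have "s = s'" using inj t by (auto simp: inj_on_def)
    then have "s = t" using s by auto
    then show "x \<in> {p}" using s t by simp
  qed
  have "(g \<longlongrightarrow> g t) (at t within {0..1})"
    using cont t by (auto simp: continuous_on_def)
  then have "\<forall>\<^sub>F s in at t within {0..1}. dist (g s) (g t) < r"
    using r(1) by (rule tendstoD)
  then obtain d where d: "d > 0" "\<And>s. s \<in> {0..1} \<Longrightarrow> s \<noteq> t \<Longrightarrow> dist s t < d \<Longrightarrow> dist (g s) (g t) < r"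
    unfolding eventually_at by blast
  have ex: "g s \<in> ball p r - {p}" if "s \<in> {0..1}" "s \<noteq> t" "dist s t < d" for s
  proof -
    have "g s \<noteq> g t" using that inj t by (auto simp: inj_on_def)
    then show ?thesis using d(2)[OF that] t(1) by (auto simp: dist_commute)
  qed
  define s1 where "s1 = max 0 (t - d/2)"
  define s2 where "s2 = min 1 (t + d/2)"
  have "g s1 \<in> ball p r - {p}" "g s2 \<in> ball p r - {p}"
    by (rule ex; use t d(1) in \<open>auto simp: s1_def s2_def dist_real_def\<close>)+
  moreover have "g s1 \<in> L" "g s2 \<in> R"
    using t d(1) by (auto simp: L_def R_def s1_def s2_def)
  ultimately have "L \<inter> (ball p r - {p}) \<noteq> {}" "R \<inter> (ball p r - {p}) \<noteq> {}" by auto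
  moreover have "L \<inter> R \<inter> (ball p r - {p}) = {}" using LR by auto
  ultimately show False using conn cL cov unfolding connected_closed by blast
qed

lemma arcs_form_loop:
  fixes g h :: "real \<Rightarrow> 'a::t2_space"
  assumes "arc g" "arc h" "pathstart g = a" "pathfinish g = b" "pathstart h = a" "pathfinish h = b"
    "path_image g \<inter> path_image h = {a, b}"
  shows "simple_path (g +++ reversepath h)"
    "pathfinish (g +++ reversepath h) = pathstart (g +++ reversepath h)"
    "path_image (g +++ reversepath h) = path_image g \<union> path_image h"
  using assms by (auto simp: simple_path_join_loop_eq arc_reversepath path_image_join)

text \<open>Winding numbers add along the theta curve: that of the loop of \<open>B\<close> and
  \<open>C\<close> is that of the loop of \<open>A\<close> and \<open>C\<close> minus that of the
  loop of \<open>A\<close> and \<open>B\<close>. Around \<open>x\<close> the subtrahend is nonzero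
  and the other term vanishes.\<close>

lemma theta_winding_inside:
  fixes A B C :: "real \<Rightarrow> complex"
  assumes "arc A" "arc B" "arc C"
    and ends: "pathstart A = a" "pathfinish A = b" "pathstart B = a" "pathfinish B = b"
      "pathstart C = a" "pathfinish C = b"
    and int: "path_image A \<inter> path_image B = {a, b}" "path_image A \<inter> path_image C = {a, b}"
      "path_image B \<inter> path_image C = {a, b}"
    and x: "x \<in> inside (path_image A \<union> path_image B)" "x \<in> outside (path_image A \<union> path_image C)"
  shows "x \<in> inside (path_image B \<union> path_image C)"
proof -
  note AB = arcs_form_loop[OF assms(1,2) ends(1-4) int(1)]
  note AC = arcs_form_loop[OF assms(1,3) ends(1,2,5,6) int(2)]
  note BC = arcs_form_loop[OF assms(2,3) ends(3-6) int(3)]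
  have notin: "x \<notin> path_image A" "x \<notin> path_image B" "x \<notin> path_image C"
    using x inside_no_overlap outside_no_overlap by fastforce+
  have p: "path A" "path B" "path C" using assms by (auto simp: arc_imp_path)
  have "winding_number (A +++ reversepath B) x \<noteq> 0"
    using simple_closed_path_norm_winding_number_inside[OF AB(1)] AB x(1)
    by (metis norm_zero zero_neq_one)
  moreover have "winding_number (A +++ reversepath C) x = 0"
    by (rule winding_number_zero_in_outside) (use AC x in \<open>auto simp: simple_path_imp_path\<close>)
  ultimately have "winding_number (B +++ reversepath C) x \<noteq> 0"
    using p notin ends by (simp add: winding_number_join winding_number_reversepath)
  moreover have "x \<in> inside (path_image B \<union> path_image C) \<or> x \<in> outside (path_image B \<union> path_image C)"
    using notin inside_Un_outside[of "path_image B \<union> path_image C"] by blast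
  ultimately show ?thesis
    using winding_number_zero_in_outside[of "B +++ reversepath C" x] BC by (auto simp: simple_path_imp_path)
qed

text \<open>As \<open>C\<close> avoids the outer side of the loop of \<open>A\<close> and
  \<open>B\<close>, it splits the inner side. What is left for \<open>h\<close> is the inside of the
  loop of \<open>B\<close> and \<open>C\<close>, whose closure misses the inner points of
  \<open>A\<close>.\<close>

lemma theta_outer_side:
  fixes A B C :: "real \<Rightarrow> complex"
  assumes arcs: "arc A" "arc B" "arc C"
    and ends: "pathstart A = a" "pathfinish A = b" "pathstart B = a" "pathfinish B = b"
      "pathstart C = a" "pathfinish C = b"
    and int: "path_image A \<inter> path_image B = {a, b}" "path_image A \<inter> path_image C = {a, b}"
      "path_image B \<inter> path_image C = {a, b}"
    and f: "outside (path_image A \<union> path_image B) \<inter> path_image C = {}"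
    and h: "h \<inter> (outside (path_image A \<union> path_image B) \<union> inside (path_image A \<union> path_image C) \<union>
               path_image A \<union> path_image B \<union> path_image C) = {}"
    and p: "p \<in> path_image A" "p \<noteq> a" "p \<noteq> b"
  shows "p \<notin> closure h"
proof -
  let ?A = "path_image A" let ?B = "path_image B" let ?C = "path_image C"
  note BC = arcs_form_loop[OF arcs(2,3) ends(3-6) int(3)]
  have ab: "a \<noteq> b" using arcs(1) ends by (metis arc_distinct_ends)
  have "infinite ?C" using uncountable_infinite[OF arc_image_uncountable[OF arcs(3)]] .
  then obtain x where x: "x \<in> ?C" "x \<noteq> a" "x \<noteq> b"
    by (metis finite.emptyI finite_insert finite_subset insertCI subsetI)
  have "x \<notin> ?A \<union> ?B" using x int by auto
  then have "x \<in> inside (?A \<union> ?B)" using f x(1) inside_Un_outside[of "?A \<union> ?B"] by blast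
  then have "?C \<inter> inside (?A \<union> ?B) \<noteq> {}" using x by auto
  then have split: "inside (?A \<union> ?C) \<union> inside (?B \<union> ?C) \<union> (?C - {a, b}) = inside (?A \<union> ?B)"
    using split_inside_simple_closed_curve[OF arcs(1)[THEN arc_imp_simple_path] ends(1,2)
        arcs(2)[THEN arc_imp_simple_path] ends(3,4) arcs(3)[THEN arc_imp_simple_path] ends(5,6) ab int]
    by blast
  have "h \<subseteq> inside (?B \<union> ?C)"
    using h split inside_Un_outside[of "?A \<union> ?B"] by blast
  moreover have "frontier (inside (?B \<union> ?C)) = ?B \<union> ?C"
    using Jordan_inside_outside[OF BC(1,2)] by (simp add: BC(3))
  ultimately have "closure h \<subseteq> inside (?B \<union> ?C) \<union> ?B \<union> ?C"
    using closure_mono[of h "inside (?B \<union> ?C)"] closure_Un_frontier[of "inside (?B \<union> ?C)"] by auto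
  moreover have "p \<notin> ?B \<union> ?C" using p int by auto
  moreover have "p \<notin> inside (?B \<union> ?C)"
    using split p(1) inside_no_overlap[of "?A \<union> ?B"] by blast
  ultimately show ?thesis by blast
qed

text \<open>Rules out a third face along an edge: \<open>A\<close> is the edge, \<open>B\<close> and
  \<open>C\<close> complete it to the boundaries of two faces \<open>f\<close> and \<open>g\<close>,
  and \<open>h\<close> is a further face. If exactly one of \<open>f\<close> and \<open>g\<close> is
  an outer side, the preceding lemma applies.\<close>

lemma theta_two_sides:
  fixes A B C :: "real \<Rightarrow> complex"
  assumes arcs: "arc A" "arc B" "arc C"
    and ends: "pathstart A = a" "pathfinish A = b" "pathstart B = a" "pathfinish B = b"
      "pathstart C = a" "pathfinish C = b"
    and int: "path_image A \<inter> path_image B = {a, b}" "path_image A \<inter> path_image C = {a, b}"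
      "path_image B \<inter> path_image C = {a, b}"
    and f: "f = inside (path_image A \<union> path_image B) \<or> f = outside (path_image A \<union> path_image B)"
      "f \<inter> path_image C = {}"
    and g: "g = inside (path_image A \<union> path_image C) \<or> g = outside (path_image A \<union> path_image C)"
      "g \<inter> path_image B = {}"
    and fg: "f \<inter> g = {}"
    and h: "h \<inter> (f \<union> g \<union> path_image A \<union> path_image B \<union> path_image C) = {}"
    and p: "p \<in> path_image A" "p \<noteq> a" "p \<noteq> b"
  shows "p \<notin> closure h"
proof -
  let ?A = "path_image A" let ?B = "path_image B" let ?C = "path_image C"
  note AB = arcs_form_loop[OF arcs(1,2) ends(1-4) int(1)]
  note BC = arcs_form_loop[OF arcs(2,3) ends(3-6) int(3)]
  have ab: "a \<noteq> b" using arcs(1) ends by (metis arc_distinct_ends)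
  consider "f = outside (?A \<union> ?B)" "g = outside (?A \<union> ?C)"
    | "f = outside (?A \<union> ?B)" "g = inside (?A \<union> ?C)"
    | "f = inside (?A \<union> ?B)" "g = outside (?A \<union> ?C)"
    | "f = inside (?A \<union> ?B)" "g = inside (?A \<union> ?C)"
    using f g by blast
  then show ?thesis
  proof cases
    case 1
    \<comment> \<open>Two outer sides always meet, since both have bounded complement.\<close>
    have "bounded (?A \<union> ?B)" "bounded (?A \<union> ?C)"
      using arcs by (auto simp: bounded_arc_image)
    then have "bounded (- (f \<inter> g))"
      using 1 by (simp add: Compl_Int cobounded_outside del: bounded_Un) (simp add: cobounded_outside)
    then show ?thesis using fg not_bounded_UNIV[where 'a=complex] by simp
  next
    case 2
    show ?thesis
      by (rule theta_outer_side[OF arcs ends int _ _ p]) (use 2 f h in auto)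
  next
    case 3
    show ?thesis
      by (rule theta_outer_side[OF arcs(1,3,2) ends(1,2,5,6,3,4) int(2,1) _ _ _ p])
        (use 3 g h int in \<open>auto simp: Int_commute\<close>)
  next
    case 4
    have JAB: "f \<noteq> {}" "frontier f = ?A \<union> ?B"
      using Jordan_inside_outside[OF AB(1,2)] 4(1) by (auto simp: AB(3))
    have JBC: "frontier (inside (?B \<union> ?C)) = ?B \<union> ?C" "open (inside (?B \<union> ?C))"
      using Jordan_inside_outside[OF BC(1,2)] by (auto simp: BC(3))
    \<comment> \<open>With both sides inner, \<open>A\<close> runs inside the loop of
      \<open>B\<close> and \<open>C\<close> and cuts that region exactly into \<open>f\<close> and
      \<open>g\<close>, leaving no room for \<open>h\<close> near \<open>p\<close>.\<close>
    have "f \<subseteq> inside (?B \<union> ?C)"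
    proof
      fix x assume x: "x \<in> f"
      then have "x \<notin> ?A \<union> ?B"
        using 4(1) inside_no_overlap[of "?A \<union> ?B"] by blast
      moreover have "x \<notin> ?C" "x \<notin> inside (?A \<union> ?C)" using x 4(2) f(2) fg by auto
      ultimately have "x \<notin> ?A" "x \<notin> ?C" "x \<notin> inside (?A \<union> ?C)" by auto
      then have "x \<in> outside (?A \<union> ?C)" using inside_Un_outside[of "?A \<union> ?C"] by blast
      then show "x \<in> inside (?B \<union> ?C)"
        using theta_winding_inside[OF arcs ends int] x 4 by blast
    qed
    then have "closure f \<subseteq> inside (?B \<union> ?C) \<union> ?B \<union> ?C"
      using closure_mono[of f "inside (?B \<union> ?C)"] closure_Un_frontier[of "inside (?B \<union> ?C)"] JBC by auto
    moreover have "p \<in> closure f" using JAB(2) p(1) by (auto simp: frontier_def)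
    moreover have "p \<notin> ?B \<union> ?C" using p int by auto
    ultimately have pin: "p \<in> inside (?B \<union> ?C)" by blast
    then have "?A \<inter> inside (?B \<union> ?C) \<noteq> {}" using p by auto
    then have split: "inside (?B \<union> ?A) \<union> inside (?C \<union> ?A) \<union> (?A - {a, b}) = inside (?B \<union> ?C)"
      using split_inside_simple_closed_curve[OF arcs(2)[THEN arc_imp_simple_path] ends(3,4)
          arcs(3)[THEN arc_imp_simple_path] ends(5,6) arcs(1)[THEN arc_imp_simple_path] ends(1,2) ab int(3)]
        int(1,2) by (simp add: Int_commute)
    then have "inside (?B \<union> ?C) \<subseteq> f \<union> g \<union> ?A"
      using 4 by (auto simp: Un_commute)
    then have "h \<inter> inside (?B \<union> ?C) = {}" using h by blast
    then have "closure h \<inter> inside (?B \<union> ?C) = {}"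
      using JBC(2) open_Int_closure_eq_empty[of "inside (?B \<union> ?C)" h] by blast
    then show ?thesis using pin by blast
  qed
qed

section \<open>The topology of plane triangulations\<close>

locale triangulation =
  fixes V :: "complex set" and E :: "complex set set"
  assumes tri: "plane_triangulation V E"
begin

abbreviation "F \<equiv> plane_faces V E"

definition bd :: "complex set \<Rightarrow> complex set set" where
  "bd f = {e \<in> E. e \<subseteq> frontier f}"

section \<open>Edges as arcs\<close>

lemma plane_graph:
  "finite V" "finite E"
  "e \<in> E \<Longrightarrow> \<exists>g. arc g \<and> path_image g = e \<and> e \<inter> V = {pathstart g, pathfinish g}"
  "e \<in> E \<Longrightarrow> e' \<in> E \<Longrightarrow> e \<noteq> e' \<Longrightarrow> e \<inter> e' \<subseteq> V"
  "e \<in> E \<Longrightarrow> e' \<in> E \<Longrightarrow> e \<noteq> e' \<Longrightarrow> e \<inter> V \<noteq> e' \<inter> V"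
  using tri unfolding plane_triangulation_def simple_plane_graph_def by auto

lemmas finite_V = plane_graph(1)
lemmas finite_E = plane_graph(2)
lemmas edge_Int = plane_graph(4)

lemma edge_unique: "e \<in> E \<Longrightarrow> e' \<in> E \<Longrightarrow> e \<inter> V = e' \<inter> V \<Longrightarrow> e = e'"
  using plane_graph(5) by blast

lemma inner_point_edge_unique: "e \<in> E \<Longrightarrow> e' \<in> E \<Longrightarrow> p \<in> e \<Longrightarrow> p \<in> e' \<Longrightarrow> p \<notin> V \<Longrightarrow> e = e'"
  using edge_Int by blast

lemma edge_arc:
  assumes "e \<in> E" "e \<inter> V = {u, v}"
  shows "\<exists>g. arc g \<and> path_image g = e \<and> pathstart g = u \<and> pathfinish g = v"
proof -
  obtain g where g: "arc g" "path_image g = e" "e \<inter> V = {pathstart g, pathfinish g}"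
    using plane_graph(3)[OF assms(1)] by blast
  then have "pathstart g = u \<and> pathfinish g = v \<or> pathstart g = v \<and> pathfinish g = u"
    using assms(2) by (metis doubleton_eq_iff)
  then show ?thesis
    using g by (auto intro: exI[of _ g] exI[of _ "reversepath g"] simp: arc_reversepath)
qed

lemma edge_ends:
  assumes "e \<in> E"
  shows "\<exists>u v. u \<noteq> v \<and> e \<inter> V = {u, v}"
proof -
  obtain g where "arc g" "e \<inter> V = {pathstart g, pathfinish g}"
    using plane_graph(3)[OF assms] by blast
  then show ?thesis using arc_distinct_ends by blast
qed

lemma edge_cases:
  assumes "e \<in> E"
  obtains u v where "u \<noteq> v" "e \<inter> V = {u, v}"
  using edge_ends[OF assms] by blast

text \<open>An arc is infinite and \<open>V\<close> is finite. Such a point lies on no other edge,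
  so it represents its edge in the topological arguments below.\<close>

lemma edge_inner_point:
  assumes "e \<in> E"
  obtains p where "p \<in> e" "p \<notin> V"
proof -
  obtain g where "arc g" "path_image g = e"
    using plane_graph(3)[OF assms] by blast
  then have "infinite e" using arc_image_uncountable uncountable_infinite by blast
  then have "\<not> e \<subseteq> V" using finite_V finite_subset by blast
  then show ?thesis using that by blast
qed

lemma
  assumes "e \<in> E"
  shows edge_closed: "closed e"
    and edge_interior: "interior e = {}"
    and edge_path_connected: "path_connected e"
proof -
  obtain g where "arc g" "path_image g = e" using plane_graph(3)[OF assms] by blast
  then show "closed e" "interior e = {}" "path_connected e"
    using closed_arc_image interior_arc_empty arc_imp_path path_connected_path_image by blast+
qed

lemma edge_subset_Union:
  assumes "e \<in> E" "A \<subseteq> E" "e \<subseteq> \<Union>A"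
  shows "e \<in> A"
proof -
  obtain p where "p \<in> e" "p \<notin> V" using edge_inner_point[OF assms(1)] .
  then show ?thesis using assms inner_point_edge_unique by blast
qed

lemma closed_graph: "closed (V \<union> \<Union>E)"
  using finite_V finite_E edge_closed by (intro closed_Un finite_imp_closed closed_Union) auto

lemma interior_graph: "interior (V \<union> \<Union>E) = {}"
proof -
  have "interior (\<Union>A) = {}" if "A \<subseteq> E" "finite A" for A
    using that(2,1)
  proof induction
    case (insert e A)
    then show ?case
      using interior_closed_Un_empty_interior[of e "\<Union>A"] edge_closed edge_interior by auto
  qed auto
  then show ?thesis
    using interior_closed_Un_empty_interior[of V "\<Union>E"] finite_V finite_E
    by (simp add: finite_imp_closed empty_interior_finite)
qed

lemma Union_faces: "\<Union>F = - (V \<union> \<Union>E)"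
  by (simp add: plane_faces_def)

lemma face_open: "f \<in> F \<Longrightarrow> open f"
  using closed_graph unfolding plane_faces_def by (meson open_Compl open_components)

lemma face_connected: "f \<in> F \<Longrightarrow> connected f"
  unfolding plane_faces_def by (rule in_components_connected)

lemma face_nonempty: "f \<in> F \<Longrightarrow> f \<noteq> {}"
  unfolding plane_faces_def by (rule in_components_nonempty)

lemma face_disjoint_graph: "f \<in> F \<Longrightarrow> f \<inter> (V \<union> \<Union>E) = {}"
  using Union_faces by blast

lemma faces_disjoint: "f \<in> F \<Longrightarrow> g \<in> F \<Longrightarrow> f \<noteq> g \<Longrightarrow> f \<inter> g = {}"
  unfolding plane_faces_def by (metis components_nonoverlap)

section \<open>Boundary loops of faces\<close>

lemma cycle_arc:
  assumes "e\<^sub>2 \<in> E" "e\<^sub>3 \<in> E" "a \<noteq> b" "c \<noteq> a" "c \<noteq> b" "e\<^sub>2 \<inter> V = {a, c}" "e\<^sub>3 \<inter> V = {c, b}"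
  obtains B where "arc B" "pathstart B = a" "pathfinish B = b" "path_image B = e\<^sub>2 \<union> e\<^sub>3"
proof -
  obtain g where g: "arc g" "path_image g = e\<^sub>2" "pathstart g = a" "pathfinish g = c"
    using edge_arc[OF assms(1,6)] by blast
  obtain h where h: "arc h" "path_image h = e\<^sub>3" "pathstart h = c" "pathfinish h = b"
    using edge_arc[OF assms(2,7)] by blast
  have "e\<^sub>2 \<noteq> e\<^sub>3" using assms by (auto simp: doubleton_eq_iff)
  then have "e\<^sub>2 \<inter> e\<^sub>3 \<subseteq> (e\<^sub>2 \<inter> V) \<inter> (e\<^sub>3 \<inter> V)" using edge_Int[OF assms(1,2)] by auto
  also have "\<dots> \<subseteq> {c}" unfolding assms(6,7) using assms(3-5) by auto
  finally have "e\<^sub>2 \<inter> e\<^sub>3 \<subseteq> {c}" .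
  then have "arc (g +++ h)" using g h by (intro arc_join) auto
  then show ?thesis using g h by (intro that[of "g +++ h"]) (auto simp: path_image_join)
qed

lemma face_cycle:
  assumes "f \<in> F"
  obtains x y z e\<^sub>1 e\<^sub>2 e\<^sub>3 where "e\<^sub>1 \<in> E" "e\<^sub>2 \<in> E" "e\<^sub>3 \<in> E" "x \<noteq> y" "y \<noteq> z" "x \<noteq> z"
    "e\<^sub>1 \<inter> V = {x, y}" "e\<^sub>2 \<inter> V = {y, z}" "e\<^sub>3 \<inter> V = {x, z}" "frontier f = e\<^sub>1 \<union> e\<^sub>2 \<union> e\<^sub>3"
    "bd f = {e\<^sub>1, e\<^sub>2, e\<^sub>3}"
proof -
  have "bounded_by_3_cycle V E f" using tri assms(1) by (simp add: plane_triangulation_def)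
  then obtain x y z e\<^sub>1 e\<^sub>2 e\<^sub>3 where *: "e\<^sub>1 \<in> E" "e\<^sub>2 \<in> E" "e\<^sub>3 \<in> E" "x \<noteq> y" "y \<noteq> z" "x \<noteq> z"
    "e\<^sub>1 \<inter> V = {x, y}" "e\<^sub>2 \<inter> V = {y, z}" "e\<^sub>3 \<inter> V = {x, z}" "frontier f = e\<^sub>1 \<union> e\<^sub>2 \<union> e\<^sub>3"
    unfolding bounded_by_3_cycle_def by (elim exE bexE conjE)
  have "d \<in> {e\<^sub>1, e\<^sub>2, e\<^sub>3}" if "d \<in> bd f" for d
  proof (rule edge_subset_Union)
    show "d \<in> E" using that by (simp add: bd_def)
    show "{e\<^sub>1, e\<^sub>2, e\<^sub>3} \<subseteq> E" using * by simp
    have "\<Union>{e\<^sub>1, e\<^sub>2, e\<^sub>3} = frontier f" using *(10) by (simp add: Un_assoc)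
    then show "d \<subseteq> \<Union>{e\<^sub>1, e\<^sub>2, e\<^sub>3}" using that by (simp add: bd_def)
  qed
  moreover have "{e\<^sub>1, e\<^sub>2, e\<^sub>3} \<subseteq> bd f" using *(1-3,10) by (simp add: bd_def le_supI1)
  ultimately have "bd f = {e\<^sub>1, e\<^sub>2, e\<^sub>3}" by blast
  then show ?thesis by (rule that[OF *])
qed

text \<open>The boundary 3-cycle as seen from a given edge with its ends in a given order. The six
  cases are the position of the edge and its direction.\<close>

lemma face_boundary:
  assumes "f \<in> F" "e \<in> bd f" "a \<noteq> b" "e \<inter> V = {a, b}"
  obtains c e\<^sub>2 e\<^sub>3 where "e\<^sub>2 \<in> E" "e\<^sub>3 \<in> E" "c \<noteq> a" "c \<noteq> b" "e\<^sub>2 \<inter> V = {a, c}" "e\<^sub>3 \<inter> V = {c, b}"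
    "frontier f = e \<union> (e\<^sub>2 \<union> e\<^sub>3)" "bd f = {e, e\<^sub>2, e\<^sub>3}"
proof -
  obtain x y z e\<^sub>1 e\<^sub>2 e\<^sub>3 where *: "e\<^sub>1 \<in> E" "e\<^sub>2 \<in> E" "e\<^sub>3 \<in> E" "x \<noteq> y" "y \<noteq> z" "x \<noteq> z"
    "e\<^sub>1 \<inter> V = {x, y}" "e\<^sub>2 \<inter> V = {y, z}" "e\<^sub>3 \<inter> V = {x, z}" "frontier f = e\<^sub>1 \<union> e\<^sub>2 \<union> e\<^sub>3"
    and bd: "bd f = {e\<^sub>1, e\<^sub>2, e\<^sub>3}"
    using face_cycle[OF assms(1)] .
  have sym: "{p, q} = {a, b} \<Longrightarrow> p = a \<and> q = b \<or> p = b \<and> q = a" for p q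
    by (auto simp: doubleton_eq_iff)
  consider "e = e\<^sub>1" "{x, y} = {a, b}" | "e = e\<^sub>2" "{y, z} = {a, b}" | "e = e\<^sub>3" "{x, z} = {a, b}"
    using assms(2,4) bd *(7-9) by (metis insertE singletonD)
  then show ?thesis
  proof cases
    case 1
    from sym[OF 1(2)] show ?thesis
    proof (elim disjE conjE)
      assume "x = a" "y = b"
      then show ?thesis using * 1(1) bd by (intro that[of e\<^sub>3 e\<^sub>2 z]) auto
    next
      assume "x = b" "y = a"
      then show ?thesis using * 1(1) bd by (intro that[of e\<^sub>2 e\<^sub>3 z]) auto
    qed
  next
    case 2
    from sym[OF 2(2)] show ?thesis
    proof (elim disjE conjE)
      assume "y = a" "z = b"
      then show ?thesis using * 2(1) bd by (intro that[of e\<^sub>1 e\<^sub>3 x]) auto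
    next
      assume "y = b" "z = a"
      then show ?thesis using * 2(1) bd by (intro that[of e\<^sub>3 e\<^sub>1 x]) auto
    qed
  next
    case 3
    from sym[OF 3(2)] show ?thesis
    proof (elim disjE conjE)
      assume "x = a" "z = b"
      then show ?thesis using * 3(1) bd by (intro that[of e\<^sub>1 e\<^sub>2 y]) auto
    next
      assume "x = b" "z = a"
      then show ?thesis using * 3(1) bd by (intro that[of e\<^sub>2 e\<^sub>1 y]) auto
    qed
  qed
qed

lemma bd_nonempty: "f \<in> F \<Longrightarrow> bd f \<noteq> {}"
  by (elim face_cycle) simp

lemma frontier_bd: "f \<in> F \<Longrightarrow> frontier f = \<Union>(bd f)"
  by (elim face_cycle) (simp add: Un_assoc)

text \<open>Cuts the boundary loop into two arcs from \<open>a\<close> to \<open>b\<close>, the edge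
  \<open>e\<close> and the rest, which is the form in which the theta lemmas take it.\<close>

lemma face_theta:
  assumes "f \<in> F" "e \<in> bd f" "a \<noteq> b" "e \<inter> V = {a, b}"
  obtains A B c e\<^sub>2 e\<^sub>3 where "e\<^sub>2 \<in> E" "e\<^sub>3 \<in> E" "c \<noteq> a" "c \<noteq> b" "e\<^sub>2 \<inter> V = {a, c}" "e\<^sub>3 \<inter> V = {c, b}"
    "frontier f = e \<union> (e\<^sub>2 \<union> e\<^sub>3)" "arc A" "pathstart A = a" "pathfinish A = b" "path_image A = e"
    "arc B" "pathstart B = a" "pathfinish B = b" "path_image B = e\<^sub>2 \<union> e\<^sub>3"
    "path_image A \<inter> path_image B = {a, b}"
proof -
  obtain c e\<^sub>2 e\<^sub>3 where *: "e\<^sub>2 \<in> E" "e\<^sub>3 \<in> E" "c \<noteq> a" "c \<noteq> b" "e\<^sub>2 \<inter> V = {a, c}" "e\<^sub>3 \<inter> V = {c, b}"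
    "frontier f = e \<union> (e\<^sub>2 \<union> e\<^sub>3)" "bd f = {e, e\<^sub>2, e\<^sub>3}"
    using face_boundary[OF assms] .
  have e: "e \<in> E" using assms by (auto simp: bd_def)
  obtain A where A: "arc A" "pathstart A = a" "pathfinish A = b" "path_image A = e"
    using edge_arc[OF e assms(4)] by blast
  obtain B where B: "arc B" "pathstart B = a" "pathfinish B = b" "path_image B = e\<^sub>2 \<union> e\<^sub>3"
    using cycle_arc[OF *(1,2) assms(3) *(3-6)] .
  have "e \<noteq> e\<^sub>2" "e \<noteq> e\<^sub>3" using * assms by (auto simp: doubleton_eq_iff)
  then have "e \<inter> e\<^sub>2 \<subseteq> V" "e \<inter> e\<^sub>3 \<subseteq> V" using e * edge_Int by auto
  then have "e \<inter> (e\<^sub>2 \<union> e\<^sub>3) \<subseteq> {a, b}" using assms(4) by blast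
  moreover have "{a, b} \<subseteq> e \<inter> (e\<^sub>2 \<union> e\<^sub>3)" using assms(4) * by blast
  ultimately have "path_image A \<inter> path_image B = {a, b}" using A B by auto
  then show ?thesis using that[OF *(1-7) A B] by blast
qed

text \<open>The face is connected and misses its frontier, so it lies on one side of the loop. That
  side is connected and misses the frontier as well, so it cannot reach beyond the face.\<close>

lemma face_side:
  assumes "f \<in> F" "simple_path c" "pathfinish c = pathstart c" "frontier f = path_image c"
  shows "f = inside (frontier f) \<or> f = outside (frontier f)"
proof -
  note J = Jordan_inside_outside[OF assms(2,3), folded assms(4)]
  have "f \<inter> frontier f = {}" using face_open[OF assms(1)] by (auto simp: frontier_def interior_open)
  then have sub: "f \<subseteq> inside (frontier f) \<union> outside (frontier f)" using J by blast
  have eq: "f = S" if S: "connected S" "S \<inter> frontier f = {}" "f \<inter> S \<noteq> {}" "f \<subseteq> S" for S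
    using connected_Int_frontier[OF S(1), of f] S face_nonempty[OF assms(1)] by blast
  have side: "inside (frontier f) \<inter> frontier f = {}" "outside (frontier f) \<inter> frontier f = {}" by auto
  have "inside (frontier f) \<inter> outside (frontier f) \<inter> f = {}" by simp
  with connectedD[OF face_connected[OF assms(1)] _ _ this sub] J
  have "inside (frontier f) \<inter> f = {} \<or> outside (frontier f) \<inter> f = {}" by blast
  then have "f \<subseteq> outside (frontier f) \<or> f \<subseteq> inside (frontier f)" using sub by blast
  then show ?thesis
  proof
    assume "f \<subseteq> outside (frontier f)"
    then show ?thesis using eq[OF _ side(2)] J face_nonempty[OF assms(1)] by (simp add: Int_absorb2)
  next
    assume "f \<subseteq> inside (frontier f)"
    then show ?thesis using eq[OF _ side(1)] J face_nonempty[OF assms(1)] by (simp add: Int_absorb2)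
  qed
qed

lemma face_loop:
  assumes "f \<in> F"
  obtains c where "simple_path c" "pathfinish c = pathstart c" "frontier f = path_image c"
proof -
  obtain e where e: "e \<in> bd f" using bd_nonempty[OF assms] by blast
  then obtain a b where ab: "a \<noteq> b" "e \<inter> V = {a, b}" using edge_cases by (auto simp: bd_def)
  obtain A B c e\<^sub>2 e\<^sub>3 where *: "arc A" "pathstart A = a" "pathfinish A = b" "path_image A = e"
    "arc B" "pathstart B = a" "pathfinish B = b" "path_image B = e\<^sub>2 \<union> e\<^sub>3"
    "path_image A \<inter> path_image B = {a, b}" "frontier f = e \<union> (e\<^sub>2 \<union> e\<^sub>3)"
    using face_theta[OF assms e ab] by metis
  show ?thesis using arcs_form_loop[OF *(1,5,2,3,6,7,9)] * by (intro that[of "A +++ reversepath B"]) auto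
qed

section \<open>The faces along an edge\<close>

text \<open>A face is one of the two sides of the union of its boundary edges, so there are at most
  two faces for each subset of \<open>E\<close>.\<close>

lemma finite_F: "finite F"
proof (rule finite_subset)
  show "F \<subseteq> (inside \<circ> Union) ` Pow E \<union> (outside \<circ> Union) ` Pow E"
  proof
    fix f assume f: "f \<in> F"
    have "bd f \<in> Pow E" by (auto simp: bd_def)
    moreover have "f = inside (\<Union>(bd f)) \<or> f = outside (\<Union>(bd f))"
      using face_loop[OF f] face_side[OF f] frontier_bd[OF f] by metis
    ultimately show "f \<in> (inside \<circ> Union) ` Pow E \<union> (outside \<circ> Union) ` Pow E" by auto
  qed
qed (use finite_E in auto)

text \<open>The graph has empty interior, so the faces are dense. As they are finitely many, closure
  commutes with their union, and a single face accumulates at \<open>p\<close> from within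
  \<open>D\<close>.\<close>

lemma face_near:
  assumes "open D" "p \<in> closure D"
  obtains f where "f \<in> F" "f \<inter> D \<noteq> {}" "p \<in> closure f"
proof -
  have "closure (\<Union>F) = UNIV"
    unfolding Union_faces closure_complement interior_graph by simp
  then have "closure (D \<inter> \<Union>F) = closure D"
    using closure_open_Int_superset[OF assms(1)] by auto
  then have "p \<in> closure (\<Union>f\<in>F. D \<inter> f)" using assms(2) by (simp only: Int_Union)
  moreover have "closed (\<Union>f\<in>F. closure (D \<inter> f))" using finite_F by (intro closed_UN) auto
  then have "closure (\<Union>f\<in>F. D \<inter> f) \<subseteq> (\<Union>f\<in>F. closure (D \<inter> f))"
    by (intro closure_minimal UN_mono subset_refl closure_subset)
  ultimately have "p \<in> (\<Union>f\<in>F. closure (D \<inter> f))" by blast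
  then obtain f where "f \<in> F" "p \<in> closure (D \<inter> f)" by blast
  moreover from this have "D \<inter> f \<noteq> {}" "p \<in> closure f" using closure_mono[of "D \<inter> f" f] by auto
  ultimately show ?thesis using that by blast
qed

lemma closure_frontier_face:
  assumes "f \<in> F" "p \<in> closure f" "p \<in> V \<union> \<Union>E"
  shows "p \<in> frontier f"
  using assms face_open[of f] face_disjoint_graph[of f] by (auto simp: frontier_def interior_open)

text \<open>One inner point is enough, because the frontier of a face is a union of whole edges and
  \<open>p\<close> lies on no edge but \<open>e\<close>.\<close>

lemma inner_point_bd:
  assumes "f \<in> F" "e \<in> E" "p \<in> e" "p \<notin> V" "p \<in> closure f"
  shows "e \<in> bd f"
proof -
  have p: "p \<in> frontier f" using closure_frontier_face assms by auto
  then obtain d where "d \<in> bd f" "p \<in> d" using frontier_bd[OF assms(1)] by blast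
  then show ?thesis using assms inner_point_edge_unique[of e d p] by (auto simp: bd_def)
qed

lemma bd_closure: "e \<in> bd f \<Longrightarrow> p \<in> e \<Longrightarrow> p \<in> closure f"
  by (auto simp: bd_def frontier_def)

text \<open>The boundaries of \<open>f\<close> and \<open>g\<close> either coincide or form a theta
  curve with \<open>e\<close> as common arc, according to whether their vertices opposite
  \<open>e\<close> agree.\<close>

lemma no_three_faces:
  assumes F: "f \<in> F" "g \<in> F" "h \<in> F" and ne: "f \<noteq> g" "f \<noteq> h" "g \<noteq> h"
    and e: "e \<in> bd f" "e \<in> bd g" "e \<in> bd h"
  shows False
proof -
  have eE: "e \<in> E" using e by (simp add: bd_def)
  obtain a b where ab: "a \<noteq> b" "e \<inter> V = {a, b}" using edge_cases[OF eE] .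
  obtain p where p: "p \<in> e" "p \<notin> V" using edge_inner_point[OF eE] .
  obtain A B c e\<^sub>2 e\<^sub>3 where f: "e\<^sub>2 \<in> E" "e\<^sub>3 \<in> E" "c \<noteq> a" "c \<noteq> b" "e\<^sub>2 \<inter> V = {a, c}" "e\<^sub>3 \<inter> V = {c, b}"
    "frontier f = e \<union> (e\<^sub>2 \<union> e\<^sub>3)" "arc A" "pathstart A = a" "pathfinish A = b" "path_image A = e"
    "arc B" "pathstart B = a" "pathfinish B = b" "path_image B = e\<^sub>2 \<union> e\<^sub>3"
    "path_image A \<inter> path_image B = {a, b}"
    using face_theta[OF F(1) e(1) ab] .
  obtain A' C c' d\<^sub>2 d\<^sub>3 where g: "d\<^sub>2 \<in> E" "d\<^sub>3 \<in> E" "c' \<noteq> a" "c' \<noteq> b" "d\<^sub>2 \<inter> V = {a, c'}" "d\<^sub>3 \<inter> V = {c', b}"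
    "frontier g = e \<union> (d\<^sub>2 \<union> d\<^sub>3)" "arc A'" "pathstart A' = a" "pathfinish A' = b" "path_image A' = e"
    "arc C" "pathstart C = a" "pathfinish C = b" "path_image C = d\<^sub>2 \<union> d\<^sub>3"
    "path_image A' \<inter> path_image C = {a, b}"
    using face_theta[OF F(2) e(2) ab] .
  obtain lf where lf: "simple_path lf" "pathfinish lf = pathstart lf" "frontier f = path_image lf"
    using face_loop[OF F(1)] .
  obtain lg where lg: "simple_path lg" "pathfinish lg = pathstart lg" "frontier g = path_image lg"
    using face_loop[OF F(2)] .
  note sf = face_side[OF F(1) lf] and sg = face_side[OF F(2) lg]
  have fgh: "h \<inter> (f \<union> g) = {}" "f \<inter> g = {}" using faces_disjoint F ne by blast+
  show False
  proof (cases "c = c'")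
    case True
    then have "e\<^sub>2 = d\<^sub>2" "e\<^sub>3 = d\<^sub>3" using f g edge_unique by auto
    then have "frontier f = frontier g" using f g by simp
    \<comment> \<open>A loop has only two sides, so \<open>f\<close> and \<open>g\<close> occupy
      both of them.\<close>
    then have sides: "f = inside (frontier f) \<and> g = outside (frontier f) \<or>
        f = outside (frontier f) \<and> g = inside (frontier f)"
      using sf sg ne(1) by metis
    have "f = inside X \<and> g = outside X \<or> f = outside X \<and> g = inside X \<Longrightarrow> f \<union> g = - X" for X
      using inside_Un_outside[of X] by (metis Un_commute)
    from this[OF sides] have "f \<union> g = - frontier f" .
    moreover have "h \<inter> frontier f = {}" unfolding f(7) using f(1,2) eE face_disjoint_graph[OF F(3)] by blast
    ultimately show False using fgh face_nonempty[OF F(3)] by blast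
  next
    case False
    have ne': "e\<^sub>2 \<noteq> d\<^sub>2" "e\<^sub>2 \<noteq> d\<^sub>3" "e\<^sub>3 \<noteq> d\<^sub>2" "e\<^sub>3 \<noteq> d\<^sub>3"
      using False f g ab by (auto simp: doubleton_eq_iff)
    have "(e\<^sub>2 \<union> e\<^sub>3) \<inter> (d\<^sub>2 \<union> d\<^sub>3) \<subseteq> V" using edge_Int f(1,2) g(1,2) ne' by blast
    then have "(e\<^sub>2 \<union> e\<^sub>3) \<inter> (d\<^sub>2 \<union> d\<^sub>3) = ((e\<^sub>2 \<inter> V) \<union> (e\<^sub>3 \<inter> V)) \<inter> ((d\<^sub>2 \<inter> V) \<union> (d\<^sub>3 \<inter> V))" by blast
    also have "\<dots> = {a, b}" unfolding f g using False f(3,4) g(3,4) by auto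
    finally have BC: "path_image B \<inter> path_image C = {a, b}" using f g by auto
    have K: "f \<inter> (V \<union> \<Union>E) = {}" "g \<inter> (V \<union> \<Union>E) = {}" "h \<inter> (V \<union> \<Union>E) = {}"
      using face_disjoint_graph F by auto
    have AC: "path_image A \<inter> path_image C = {a, b}" using f(11) g(11,16) by auto
    have "p \<notin> closure h"
    proof (rule theta_two_sides[OF f(8,12) g(12) f(9,10,13,14) g(13,14) f(16) AC BC])
      show "f = inside (path_image A \<union> path_image B) \<or> f = outside (path_image A \<union> path_image B)"
        using sf f by auto
      show "g = inside (path_image A \<union> path_image C) \<or> g = outside (path_image A \<union> path_image C)"
        using sg f g by auto
      have sub: "path_image A \<subseteq> V \<union> \<Union>E" "path_image B \<subseteq> V \<union> \<Union>E" "path_image C \<subseteq> V \<union> \<Union>E"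
        unfolding f(11,15) g(15) using f(1,2) g(1,2) eE by blast+
      show "f \<inter> path_image C = {}" using K(1) sub(3) by blast
      show "g \<inter> path_image B = {}" using K(2) sub(2) by blast
      show "h \<inter> (f \<union> g \<union> path_image A \<union> path_image B \<union> path_image C) = {}"
        using K(3) fgh(1) sub by blast
    qed (use fgh p f ab in auto)
    then show False using bd_closure[OF e(3) p(1)] by blast
  qed
qed

text \<open>Some face \<open>f\<close> comes near an inner point of \<open>e\<close>. The side of
  its boundary loop away from \<open>f\<close> has \<open>e\<close> on its frontier too, so a second
  face approaches \<open>e\<close> from there.\<close>

lemma edge_two_faces:
  assumes "e \<in> E"
  obtains f g where "f \<noteq> g" "{h \<in> F. e \<in> bd h} = {f, g}"
proof -
  obtain p where p: "p \<in> e" "p \<notin> V" using edge_inner_point[OF assms] .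
  obtain f where f: "f \<in> F" "p \<in> closure f" using face_near[of UNIV p] by auto
  have ef: "e \<in> bd f" by (rule inner_point_bd[OF f(1) assms p f(2)])
  obtain c where c: "simple_path c" "pathfinish c = pathstart c" "frontier f = path_image c"
    using face_loop[OF f(1)] .
  note J = Jordan_inside_outside[OF c(1,2), folded c(3)]
  obtain D where D: "open D" "frontier D = frontier f" "D \<inter> f = {}"
    using face_side[OF f(1) c] J by (metis Int_commute)
  have "p \<in> closure D" using D(2) ef p(1) by (auto simp: bd_def frontier_def)
  then obtain g where g: "g \<in> F" "g \<inter> D \<noteq> {}" "p \<in> closure g" using face_near[OF D(1)] by blast
  have "e \<in> bd g" by (rule inner_point_bd[OF g(1) assms p g(3)])
  moreover have "f \<noteq> g" using D g by auto
  ultimately have "{h \<in> F. e \<in> bd h} = {f, g}" using ef f g no_three_faces by blast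
  then show ?thesis using that \<open>f \<noteq> g\<close> by blast
qed

section \<open>Dual connectivity and separation by cycles\<close>

text \<open>The plane minus the finite set \<open>V\<close> is connected. The closures of the faces
  in \<open>X\<close> and of the other faces cover it, and off \<open>V\<close> they could meet only
  in an inner point of an edge shared by a face of each kind.\<close>

lemma dual_connected:
  assumes "X \<subseteq> F" "X \<noteq> {}"
    and step: "\<And>f g. f \<in> X \<Longrightarrow> g \<in> F \<Longrightarrow> f \<noteq> g \<Longrightarrow> bd f \<inter> bd g \<noteq> {} \<Longrightarrow> g \<in> X"
  shows "X = F"
proof (rule ccontr)
  assume "X \<noteq> F"
  then obtain g where g: "g \<in> F" "g \<notin> X" using assms(1) by blast
  obtain f where f: "f \<in> X" using assms(2) by blast
  define P where "P = (\<Union>f\<in>X. closure f)"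
  define Q where "Q = (\<Union>f\<in>F - X. closure f)"
  have fin: "finite X" "finite (F - X)" using finite_F assms(1) finite_subset by auto
  have "connected (UNIV - V)"
    by (rule connected_open_diff_countable) (use finite_V in \<open>auto simp: uncountable_infinite countable_finite\<close>)
  moreover have "closed P" "closed Q" unfolding P_def Q_def using fin by (auto intro!: closed_UN)
  moreover have "UNIV - V \<subseteq> P \<union> Q"
  proof
    fix p :: complex
    obtain f where "f \<in> F" "p \<in> closure f" using face_near[of UNIV p] by auto
    then show "p \<in> P \<union> Q" by (auto simp: P_def Q_def)
  qed
  moreover have "P \<inter> Q \<inter> (UNIV - V) = {}"
  proof (rule ccontr)
    assume "P \<inter> Q \<inter> (UNIV - V) \<noteq> {}"
    then obtain p h k where p: "p \<notin> V" "h \<in> X" "p \<in> closure h" "k \<in> F" "k \<notin> X" "p \<in> closure k"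
      by (auto simp: P_def Q_def)
    have h: "h \<in> F" "h \<noteq> k" using p assms(1) by auto
    have "p \<notin> h'" if "h' \<in> F" "k' \<in> F" "h' \<noteq> k'" "p \<in> closure k'" for h' k'
      using open_Int_closure_eq_empty[OF face_open[OF that(1)], of k'] faces_disjoint[OF that(1-3)] that(4) by blast
    then have "p \<notin> \<Union>F" using p h by (metis UnionE)
    then obtain e where e: "e \<in> E" "p \<in> e" using p(1) Union_faces by blast
    then have "e \<in> bd h" "e \<in> bd k" using inner_point_bd p h by auto
    then show False using step[OF p(2,4)] p(5) h by blast
  qed
  moreover have "f \<subseteq> P \<inter> (UNIV - V)" "g \<subseteq> Q \<inter> (UNIV - V)"
    using f g assms(1) closure_subset[of f] closure_subset[of g] face_disjoint_graph[of f] face_disjoint_graph[of g]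
    unfolding P_def Q_def by blast+
  then have "P \<inter> (UNIV - V) \<noteq> {}" "Q \<inter> (UNIV - V) \<noteq> {}"
    using face_nonempty f g assms(1) by blast+
  ultimately show False unfolding connected_closed by blast
qed

lemma face_sides_of_loop:
  assumes "f \<in> F" "simple_path c" "pathfinish c = pathstart c" "path_image c \<subseteq> \<Union>E"
  shows "f \<subseteq> inside (path_image c) \<or> f \<subseteq> outside (path_image c)"
proof -
  note J = Jordan_inside_outside[OF assms(2,3)]
  have "f \<inter> path_image c = {}" using face_disjoint_graph[OF assms(1)] assms(4) by blast
  then have sub: "f \<subseteq> inside (path_image c) \<union> outside (path_image c)" using J by blast
  have "inside (path_image c) \<inter> outside (path_image c) \<inter> f = {}" by simp
  with connectedD[OF face_connected[OF assms(1)] _ _ this sub] J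
  have "inside (path_image c) \<inter> f = {} \<or> outside (path_image c) \<inter> f = {}" by blast
  then show ?thesis using sub by blast
qed

lemma face_within_side:
  assumes "f \<in> F" "simple_path c" "pathfinish c = pathstart c" "path_image c \<subseteq> \<Union>E"
  shows "f \<inter> inside (path_image c) \<noteq> {} \<Longrightarrow> f \<subseteq> inside (path_image c)"
    and "f \<inter> outside (path_image c) \<noteq> {} \<Longrightarrow> f \<subseteq> outside (path_image c)"
proof -
  have "f \<subseteq> A" if "f \<subseteq> A \<or> f \<subseteq> B" "A \<inter> B = {}" "f \<inter> A \<noteq> {}" for A B using that by blast
  then show "f \<inter> inside (path_image c) \<noteq> {} \<Longrightarrow> f \<subseteq> inside (path_image c)"
    "f \<inter> outside (path_image c) \<noteq> {} \<Longrightarrow> f \<subseteq> outside (path_image c)"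
    using face_sides_of_loop[OF assms] inside_Int_outside[of "path_image c"] by (metis Int_commute)+
qed

text \<open>The edge \<open>e\<close> and an arc through \<open>E'\<close> form a Jordan curve with
  \<open>f\<close> and \<open>g\<close> on different sides. A dual step across an edge outside
  \<open>insert e E'\<close> does not cross this curve.\<close>

lemma cycle_separates:
  assumes E': "E' \<subseteq> E" and e: "e \<in> E" "e \<notin> E'" "e \<inter> V = {u, v}" "u \<noteq> v"
    and conn: "(u, v) \<in> {(x, y). \<exists>d\<in>E'. d \<inter> V = {x, y}}\<^sup>*"
    and fg: "f \<in> F" "g \<in> F" "f \<noteq> g" "e \<in> bd f" "e \<in> bd g"
  shows "(f, g) \<notin> {(h, k). h \<in> F \<and> k \<in> F \<and> (\<exists>d\<in>E - insert e E'. d \<in> bd h \<and> d \<in> bd k)}\<^sup>*"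
proof -
  have "u = w \<or> path_component (\<Union>E') u w" if "(u, w) \<in> {(x, y). \<exists>d\<in>E'. d \<inter> V = {x, y}}\<^sup>*" for w
    using that
  proof induction
    case (step y z)
    then obtain d where d: "d \<in> E'" "d \<inter> V = {y, z}" by blast
    then have "path_component d y z" using edge_path_connected[of d] E' by (auto simp: path_connected_component)
    then have "path_component (\<Union>E') y z" using d by (meson Union_upper path_component_of_subset)
    then show ?case using step path_component_trans by blast
  qed auto
  then have "path_component (\<Union>E') u v" using conn e by blast
  then obtain q where q: "path q" "path_image q \<subseteq> \<Union>E'" "pathstart q = u" "pathfinish q = v"
    unfolding path_component_def by blast
  \<comment> \<open>Passing to point sets yields an arc without selecting edges for it. It meets
    \<open>e\<close> only in \<open>u\<close> and \<open>v\<close>, since \<open>e\<close> is not in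
    \<open>E'\<close>.\<close>
  obtain h where h: "arc h" "path_image h \<subseteq> path_image q" "pathstart h = u" "pathfinish h = v"
    using path_contains_arc[OF q(1,3,4) e(4)] .
  obtain k where k: "arc k" "path_image k = e" "pathstart k = u" "pathfinish k = v"
    using edge_arc[OF e(1,3)] by blast
  have h_sub: "path_image h \<subseteq> \<Union>E'" using h q by blast
  have "path_image k \<inter> path_image h \<subseteq> e \<inter> V"
  proof
    fix x assume "x \<in> path_image k \<inter> path_image h"
    then obtain d where "d \<in> E'" "x \<in> d" "x \<in> e" using h_sub k by auto
    then show "x \<in> e \<inter> V" using edge_Int[of e d] e E' by blast
  qed
  moreover have "{u, v} \<subseteq> path_image k \<inter> path_image h"
    using h k by (metis Int_iff empty_subsetI insert_subset pathfinish_in_path_image pathstart_in_path_image)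
  ultimately have kh: "path_image k \<inter> path_image h = {u, v}" using e(3) by auto
  define c where "c = k +++ reversepath h"
  have c: "simple_path c" "pathfinish c = pathstart c" "path_image c = e \<union> path_image h"
    using arcs_form_loop[OF k(1) h(1) k(3,4) h(3,4) kh] k(2) by (auto simp: c_def)
  have cE: "path_image c \<subseteq> \<Union>E" using c(3) h_sub e(1) E' by blast
  note J = Jordan_inside_outside[OF c(1,2)]
  obtain p where p: "p \<in> e" "p \<notin> V" using edge_inner_point[OF e(1)] .
  \<comment> \<open>Both sides of the curve have \<open>p\<close> on their frontier, so each
    contains a face along \<open>e\<close>; as \<open>e\<close> has no third face, these two are
    \<open>f\<close> and \<open>g\<close>.\<close>
  have "p \<in> closure (inside (path_image c))" "p \<in> closure (outside (path_image c))"
    using J p c(3) by (auto simp: frontier_def)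
  then obtain f' g' where fg': "f' \<in> F" "f' \<inter> inside (path_image c) \<noteq> {}" "p \<in> closure f'"
    "g' \<in> F" "g' \<inter> outside (path_image c) \<noteq> {}" "p \<in> closure g'"
    using J face_near by metis
  have side: "f' \<subseteq> inside (path_image c)" "g' \<subseteq> outside (path_image c)"
    using face_within_side[OF _ c(1,2) cE] fg' by auto
  have "e \<in> bd f'" "e \<in> bd g'" using inner_point_bd fg' e(1) p by auto
  moreover have "f' \<noteq> g'" using side fg'(2,5) inside_Int_outside[of "path_image c"] by blast
  ultimately have "{f', g'} = {f, g}"
    using no_three_faces[OF fg(1,2) _ fg(3) _ _ fg(4,5)] fg' by (metis insert_commute)
  then have sep: "f \<subseteq> inside (path_image c) \<and> g \<subseteq> outside (path_image c) \<or>
      f \<subseteq> outside (path_image c) \<and> g \<subseteq> inside (path_image c)"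
    using side by (auto simp: doubleton_eq_iff)
  \<comment> \<open>Lying inside is invariant along a dual walk: an inner point of the crossed edge
    is off the curve, and the open side around it meets both faces.\<close>
  have same: "x \<subseteq> inside (path_image c) \<longleftrightarrow> y \<subseteq> inside (path_image c)"
    if "(x, y) \<in> {(h, k). h \<in> F \<and> k \<in> F \<and> (\<exists>d\<in>E - insert e E'. d \<in> bd h \<and> d \<in> bd k)}\<^sup>*" for x y
    using that
  proof induction
    case (step y z)
    then obtain d where d: "y \<in> F" "z \<in> F" "d \<in> E" "d \<noteq> e" "d \<notin> E'" "d \<in> bd y" "d \<in> bd z" by blast
    obtain q where q: "q \<in> d" "q \<notin> V" using edge_inner_point[OF d(3)] .
    have "q \<notin> path_image c"
    proof
      assume "q \<in> path_image c"
      then obtain d' where "d' \<in> insert e E'" "q \<in> d'" using c(3) h_sub by auto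
      then show False using inner_point_edge_unique[of d d' q] d q e E' by blast
    qed
    then have "q \<in> inside (path_image c) \<or> q \<in> outside (path_image c)" using J by blast
    moreover have "y \<inter> S \<noteq> {} \<and> z \<inter> S \<noteq> {}" if "open S" "q \<in> S" for S
    proof -
      have "q \<in> closure y" "q \<in> closure z" using bd_closure d q by auto
      then show ?thesis
        using open_Int_closure_eq_empty[OF that(1), of y] open_Int_closure_eq_empty[OF that(1), of z] that(2) by blast
    qed
    ultimately have "y \<inter> inside (path_image c) \<noteq> {} \<and> z \<inter> inside (path_image c) \<noteq> {} \<or>
        y \<inter> outside (path_image c) \<noteq> {} \<and> z \<inter> outside (path_image c) \<noteq> {}"
      using J by metis
    then have "y \<subseteq> inside (path_image c) \<and> z \<subseteq> inside (path_image c) \<or>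
        y \<subseteq> outside (path_image c) \<and> z \<subseteq> outside (path_image c)"
      using face_within_side[OF d(1) c(1,2) cE] face_within_side[OF d(2) c(1,2) cE] by metis
    then have "y \<subseteq> inside (path_image c) \<longleftrightarrow> z \<subseteq> inside (path_image c)"
      using inside_Int_outside[of "path_image c"] face_nonempty[OF d(1)] face_nonempty[OF d(2)] by blast
    then show ?case using step.IH by simp
  qed simp
  show ?thesis
  proof
    assume "(f, g) \<in> {(h, k). h \<in> F \<and> k \<in> F \<and> (\<exists>d\<in>E - insert e E'. d \<in> bd h \<and> d \<in> bd k)}\<^sup>*"
    then have "f \<subseteq> inside (path_image c) \<longleftrightarrow> g \<subseteq> inside (path_image c)" by (rule same)
    then show False
      using sep face_nonempty[OF fg(1)] face_nonempty[OF fg(2)] inside_Int_outside[of "path_image c"] by blast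
  qed
qed

lemma vertex_on_face:
  assumes "v \<in> V"
  obtains f where "f \<in> F" "v \<in> frontier f"
proof -
  obtain f where "f \<in> F" "v \<in> closure f" using face_near[of UNIV v] by auto
  then show ?thesis using closure_frontier_face assms that by blast
qed

end

section \<open>Counting edges of subgraphs\<close>

text \<open>For symmetric \<open>r\<close> these are the connected components, traced on
  \<open>A\<close>. Applied to faces linked across the edges outside a subgraph, they stand for the
  faces of that subgraph.\<close>

definition reach_classes :: "'a set \<Rightarrow> ('a \<times> 'a) set \<Rightarrow> 'a set set" where
  "reach_classes A r = (\<lambda>x. {y \<in> A. (x, y) \<in> r\<^sup>*}) ` A"

lemma reach_class_eq_iff:
  assumes "sym r" "x \<in> A" "y \<in> A"
  shows "{z \<in> A. (x, z) \<in> r\<^sup>*} = {z \<in> A. (y, z) \<in> r\<^sup>*} \<longleftrightarrow> (x, y) \<in> r\<^sup>*"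
proof
  assume "(x, y) \<in> r\<^sup>*"
  moreover have "(y, x) \<in> r\<^sup>*" using calculation assms(1) by (meson sym_rtrancl symD)
  ultimately show "{z \<in> A. (x, z) \<in> r\<^sup>*} = {z \<in> A. (y, z) \<in> r\<^sup>*}" by (auto intro: rtrancl_trans)
qed (use assms in auto)

text \<open>Sending a class of \<open>r\<close> to the class of \<open>s\<close> containing it is
  onto. A pair joined by \<open>s\<close> but not by \<open>r\<close> makes this map
  non-injective.\<close>

lemma reach_classes_mono:
  assumes "finite A" "sym r" "sym s" "r \<subseteq> s\<^sup>*"
  shows "card (reach_classes A s) \<le> card (reach_classes A r)"
    and "a \<in> A \<Longrightarrow> b \<in> A \<Longrightarrow> (a, b) \<in> s\<^sup>* \<Longrightarrow> (a, b) \<notin> r\<^sup>* \<Longrightarrow>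
      card (reach_classes A s) < card (reach_classes A r)"
proof -
  define f where "f X = {y \<in> A. \<exists>x\<in>X. (x, y) \<in> s\<^sup>*}" for X
  have rs: "r\<^sup>* \<subseteq> s\<^sup>*" using assms(4) by (metis rtrancl_idemp rtrancl_mono)
  have f: "f {z \<in> A. (x, z) \<in> r\<^sup>*} = {z \<in> A. (x, z) \<in> s\<^sup>*}" if "x \<in> A" for x
    unfolding f_def using that rs by (auto intro: rtrancl_trans)
  have im: "reach_classes A s = f ` reach_classes A r"
    unfolding reach_classes_def image_image using f by (intro image_cong) auto
  have fin: "finite (reach_classes A r)" using assms(1) by (simp add: reach_classes_def)
  show "card (reach_classes A s) \<le> card (reach_classes A r)"
    unfolding im by (rule card_image_le[OF fin])
  assume ab: "a \<in> A" "b \<in> A" "(a, b) \<in> s\<^sup>*" "(a, b) \<notin> r\<^sup>*"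
  have "\<not> inj_on f (reach_classes A r)"
  proof
    assume inj: "inj_on f (reach_classes A r)"
    have "f {z \<in> A. (a, z) \<in> r\<^sup>*} = f {z \<in> A. (b, z) \<in> r\<^sup>*}"
      using f ab reach_class_eq_iff[OF assms(3) ab(1,2)] by simp
    then have "{z \<in> A. (a, z) \<in> r\<^sup>*} = {z \<in> A. (b, z) \<in> r\<^sup>*}"
      by (rule inj_onD[OF inj]) (use ab(1,2) in \<open>auto simp: reach_classes_def\<close>)
    then show False using reach_class_eq_iff[OF assms(2) ab(1,2)] ab(4) by simp
  qed
  then show "card (reach_classes A s) < card (reach_classes A r)"
    unfolding im using card_image_le[OF fin, of f] eq_card_imp_inj_on[OF fin, of f] by linarith
qed

lemma card_filter_sum: "finite A \<Longrightarrow> card {x \<in> A. P x} = (\<Sum>x\<in>A. if P x then 1 else (0::nat))"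
  by (simp add: sum.If_cases Int_def)

section \<open>Euler's inequality and 5-degeneracy\<close>

text \<open>The facts that the counting uses, stripped of topology. Of the boundary triangles only
  their even degrees are kept, and \<open>separates\<close> carries the Jordan curve
  theorem.\<close>

locale spherical_triangulation =
  fixes V :: "'v set" and E :: "'e set" and F :: "'f set"
    and ends :: "'e \<Rightarrow> 'v set" and bd :: "'f \<Rightarrow> 'e set"
  assumes fin: "finite V" "finite E" "finite F"
    and ends: "e \<in> E \<Longrightarrow> ends e \<subseteq> V \<and> card (ends e) = 2"
    and ends_inj: "inj_on ends E"
    and bd_sub: "f \<in> F \<Longrightarrow> bd f \<subseteq> E"
    and bd_even: "f \<in> F \<Longrightarrow> even (card {e \<in> bd f. v \<in> ends e})"
    and two_faces: "e \<in> E \<Longrightarrow> card {f \<in> F. e \<in> bd f} = 2"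
    and F_nonempty: "F \<noteq> {}"
    and dual_conn: "X \<subseteq> F \<Longrightarrow> X \<noteq> {} \<Longrightarrow>
      (\<And>f g. f \<in> X \<Longrightarrow> g \<in> F \<Longrightarrow> f \<noteq> g \<Longrightarrow> bd f \<inter> bd g \<noteq> {} \<Longrightarrow> g \<in> X) \<Longrightarrow> X = F"
    and separates: "E' \<subseteq> E \<Longrightarrow> e \<in> E \<Longrightarrow> e \<notin> E' \<Longrightarrow> ends e = {u, v} \<Longrightarrow> u \<noteq> v \<Longrightarrow>
      (u, v) \<in> {(x, y). \<exists>d\<in>E'. ends d = {x, y}}\<^sup>* \<Longrightarrow>
      f \<in> F \<Longrightarrow> g \<in> F \<Longrightarrow> f \<noteq> g \<Longrightarrow> e \<in> bd f \<Longrightarrow> e \<in> bd g \<Longrightarrow>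
      (f, g) \<notin> {(h, k). h \<in> F \<and> k \<in> F \<and> (\<exists>d\<in>E - insert e E'. d \<in> bd h \<and> d \<in> bd k)}\<^sup>*"
begin

definition link :: "'e set \<Rightarrow> ('v \<times> 'v) set" where
  "link D = {(x, y). \<exists>d\<in>D. ends d = {x, y}}"

definition dual_link :: "'e set \<Rightarrow> ('f \<times> 'f) set" where
  "dual_link D = {(h, k). h \<in> F \<and> k \<in> F \<and> (\<exists>d\<in>D. d \<in> bd h \<and> d \<in> bd k)}"

lemma sym_links: "sym (link D)" "sym (dual_link D)"
  by (auto simp: sym_def link_def dual_link_def insert_commute)

lemma edge_faces:
  assumes "e \<in> E"
  obtains f g where "f \<noteq> g" "{h \<in> F. e \<in> bd h} = {f, g}"
  using two_faces[OF assms] by (auto simp: card_2_iff)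

text \<open>Half of Euler's formula for the subgraph with vertex set \<open>S\<close> and edge set
  \<open>D\<close>. A new edge either closes a cycle, and then splits a class of faces by
  \<open>separates\<close>, or joins two components.\<close>

lemma euler_inequality:
  assumes "S \<subseteq> V" "D \<subseteq> E" "\<And>e. e \<in> D \<Longrightarrow> ends e \<subseteq> S"
  shows "card D + card (reach_classes S (link D)) + 1 \<le> card (reach_classes F (dual_link (E - D))) + card S"
proof -
  have "finite D" "finite S" using assms(1,2) fin finite_subset by blast+
  then show ?thesis using assms(2,3)
  proof (induction D)
    case empty
    have "reach_classes F (dual_link E) \<noteq> {}" using F_nonempty by (simp add: reach_classes_def)
    then have "card (reach_classes F (dual_link E)) \<ge> 1"
      using fin by (simp add: reach_classes_def Suc_le_eq card_gt_0_iff)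
    moreover have "card (reach_classes S (link {})) \<le> card S"
      unfolding reach_classes_def using empty by (intro card_image_le) auto
    ultimately show ?case by simp
  next
    case (insert e D)
    then have e: "e \<in> E" "e \<notin> D" "D \<subseteq> E" "ends e \<subseteq> S" by auto
    obtain u v where uv: "ends e = {u, v}" "u \<noteq> v" using ends[OF e(1)] by (auto simp: card_2_iff)
    obtain f g where fg: "f \<noteq> g" "{h \<in> F. e \<in> bd h} = {f, g}" using edge_faces[OF e(1)] .
    have dsub: "dual_link (E - insert e D) \<subseteq> (dual_link (E - D))\<^sup>*" by (auto simp: dual_link_def)
    have vsub: "link D \<subseteq> (link (insert e D))\<^sup>*" by (auto simp: link_def)
    have fgF: "f \<in> F" "g \<in> F" "e \<in> bd f" "e \<in> bd g" using fg(2) by auto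
    have fg_adj: "(f, g) \<in> (dual_link (E - D))\<^sup>*" using fgF e by (auto simp: dual_link_def)
    have uv_adj: "(u, v) \<in> (link (insert e D))\<^sup>*" using uv by (auto simp: link_def)
    have IH: "card D + card (reach_classes S (link D)) + 1 \<le> card (reach_classes F (dual_link (E - D))) + card S"
      by (rule insert.IH) (use insert.prems \<open>finite S\<close> in auto)
    show ?case
    proof (cases "(u, v) \<in> (link D)\<^sup>*")
      case True
      have "(f, g) \<notin> (dual_link (E - insert e D))\<^sup>*"
        using separates[OF e(3,1,2) uv] True fgF fg(1) by (simp add: link_def dual_link_def)
      then have "card (reach_classes F (dual_link (E - D))) < card (reach_classes F (dual_link (E - insert e D)))"
        using reach_classes_mono(2)[OF fin(3) sym_links(2) sym_links(2) dsub] fgF fg_adj by blast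
      moreover have "card (reach_classes S (link (insert e D))) \<le> card (reach_classes S (link D))"
        using reach_classes_mono(1)[OF \<open>finite S\<close> sym_links(1) sym_links(1) vsub] .
      ultimately show ?thesis using IH insert by simp
    next
      case False
      have "card (reach_classes F (dual_link (E - D))) \<le> card (reach_classes F (dual_link (E - insert e D)))"
        using reach_classes_mono(1)[OF fin(3) sym_links(2) sym_links(2) dsub] .
      moreover have "card (reach_classes S (link (insert e D))) < card (reach_classes S (link D))"
        using reach_classes_mono(2)[OF \<open>finite S\<close> sym_links(1) sym_links(1) vsub _ _ uv_adj False] e uv by blast
      ultimately show ?thesis using IH insert by simp
    qed
  qed
qed

text \<open>The edges on exactly one face of \<open>X\<close> form a nonempty even subgraph, hence at least a triangle.\<close>

lemma boundary_ge_3: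
  assumes X: "X \<subseteq> F" "X \<noteq> {}" "X \<noteq> F"
    and closed: "\<And>f g d. f \<in> X \<Longrightarrow> g \<in> F \<Longrightarrow> d \<in> E - D \<Longrightarrow> d \<in> bd f \<Longrightarrow> d \<in> bd g \<Longrightarrow> g \<in> X"
  shows "3 \<le> (\<Sum>f\<in>X. card (bd f \<inter> D))"
proof -
  have finX: "finite X" using X fin finite_subset by blast
  have fin_bd: "finite (bd f)" if "f \<in> F" for f using bd_sub[OF that] fin finite_subset by blast
  define n where "n e = card {f \<in> X. e \<in> bd f}" for e
  define B where "B = {e \<in> E. n e = 1}"
  have n2: "n e \<le> 2" if "e \<in> E" for e
  proof -
    have "card {f \<in> X. e \<in> bd f} \<le> card {f \<in> F. e \<in> bd f}" using X(1) fin(3) by (intro card_mono) auto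
    then show ?thesis using two_faces[OF that] by (simp add: n_def)
  qed
  \<comment> \<open>The boundaries of the faces in \<open>X\<close> have an even total of incidences
    at \<open>v\<close>. An edge is counted \<open>n e\<close> times, at most twice, so modulo 2
    only the edges of \<open>B\<close> remain.\<close>
  have even: "even (card {e \<in> B. v \<in> ends e})" for v
  proof -
    have "even (\<Sum>f\<in>X. card {e \<in> bd f. v \<in> ends e})" using X(1) bd_even by (intro dvd_sum) auto
    also have "(\<Sum>f\<in>X. card {e \<in> bd f. v \<in> ends e}) = (\<Sum>f\<in>X. \<Sum>e\<in>E. if e \<in> bd f \<and> v \<in> ends e then 1 else 0)"
    proof (intro sum.cong refl)
      fix f assume "f \<in> X"
      then have "{e \<in> bd f. v \<in> ends e} = {e \<in> E. e \<in> bd f \<and> v \<in> ends e}" using bd_sub X(1) by blast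
      then show "card {e \<in> bd f. v \<in> ends e} = (\<Sum>e\<in>E. if e \<in> bd f \<and> v \<in> ends e then 1 else 0)"
        using card_filter_sum[OF fin(2)] by simp
    qed
    also have "\<dots> = (\<Sum>e\<in>E. \<Sum>f\<in>X. if e \<in> bd f \<and> v \<in> ends e then 1 else 0)" by (rule sum.swap)
    also have "\<dots> = (\<Sum>e\<in>{e\<in>E. v \<in> ends e}. n e)"
      using fin(2) by (intro sum.mono_neutral_cong_right) (auto simp: n_def card_filter_sum[OF finX])
    also have "\<dots> = (\<Sum>e\<in>{e\<in>E. v \<in> ends e} \<inter> B. n e) + (\<Sum>e\<in>{e\<in>E. v \<in> ends e} - B. n e)"
      using fin(2) by (intro sum.Int_Diff) auto
    also have "(\<Sum>e\<in>{e\<in>E. v \<in> ends e} \<inter> B. n e) = card {e \<in> B. v \<in> ends e}"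
    proof -
      have "{e\<in>E. v \<in> ends e} \<inter> B = {e \<in> B. v \<in> ends e}" by (auto simp: B_def)
      then show ?thesis by (simp add: B_def)
    qed
    finally have "even (card {e \<in> B. v \<in> ends e} + (\<Sum>e\<in>{e\<in>E. v \<in> ends e} - B. n e))" .
    moreover have "even (\<Sum>e\<in>{e\<in>E. v \<in> ends e} - B. n e)"
    proof (intro dvd_sum)
      fix e assume "e \<in> {e\<in>E. v \<in> ends e} - B"
      then have "n e = 0 \<or> n e = 2" using n2[of e] by (auto simp: B_def)
      then show "even (n e)" by auto
    qed
    ultimately show ?thesis by simp
  qed
  have BD: "B \<subseteq> D"
  proof
    fix e assume e: "e \<in> B"
    show "e \<in> D"
    proof (rule ccontr)
      assume "e \<notin> D"
      have "card {f \<in> X. e \<in> bd f} = 1" "e \<in> E" using e by (auto simp: B_def n_def)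
      then obtain f where f: "{f \<in> X. e \<in> bd f} = {f}" by (auto simp: card_1_singleton_iff)
      then have "{g \<in> F. e \<in> bd g} \<subseteq> {f \<in> X. e \<in> bd f}"
        using closed[of f _ e] \<open>e \<in> E\<close> \<open>e \<notin> D\<close> by blast
      then have "card {g \<in> F. e \<in> bd g} \<le> 1" unfolding f by (metis card_mono finite.emptyI finite_insert is_singletonI is_singleton_altdef)
      then show False using two_faces[OF \<open>e \<in> E\<close>] by simp
    qed
  qed
  have other: "\<exists>d\<in>B. d \<noteq> e \<and> v \<in> ends d" if "e \<in> B" "v \<in> ends e" for e v
  proof (rule ccontr)
    assume "\<not> (\<exists>d\<in>B. d \<noteq> e \<and> v \<in> ends d)"
    then have "{e \<in> B. v \<in> ends e} = {e}" using that by auto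
    then show False using even[of v] by simp
  qed
  \<comment> \<open>Dual connectivity gives an edge between \<open>X\<close> and its complement,
    which lies in \<open>B\<close>. Evenness gives a further edge of \<open>B\<close> at each of its
    ends, and these two differ because there are no parallel edges.\<close>
  obtain f g where fg: "f \<in> X" "g \<in> F" "g \<notin> X" "bd f \<inter> bd g \<noteq> {}"
    using dual_conn[OF X(1,2)] X(3) by blast
  then obtain e where e: "e \<in> bd f" "e \<in> bd g" by blast
  have eE: "e \<in> E" using e bd_sub fg X by blast
  have "{h \<in> X. e \<in> bd h} = {f}"
  proof -
    obtain h k where "{h \<in> F. e \<in> bd h} = {h, k}" using edge_faces[OF eE] by metis
    then show ?thesis using e fg X(1) by (smt (verit) Collect_cong insert_iff mem_Collect_eq singleton_conv singletonD subsetD)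
  qed
  then have eB: "e \<in> B" using eE by (simp add: B_def n_def)
  obtain u v where uv: "ends e = {u, v}" "u \<noteq> v" using ends[OF eE] by (auto simp: card_2_iff)
  obtain d1 where d1: "d1 \<in> B" "d1 \<noteq> e" "u \<in> ends d1" using other[OF eB, of u] uv by auto
  obtain d2 where d2: "d2 \<in> B" "d2 \<noteq> e" "v \<in> ends d2" using other[OF eB, of v] uv by auto
  have "d1 \<noteq> d2"
  proof
    assume "d1 = d2"
    then have "{u, v} \<subseteq> ends d1" using d1 d2 by auto
    moreover have "card (ends d1) = 2" "finite (ends d1)"
      using ends[of d1] d1(1) by (auto simp: B_def intro!: card_ge_0_finite)
    ultimately have "ends e = ends d1" unfolding uv(1) using uv(2) by (intro card_subset_eq) auto
    then show False using inj_onD[OF ends_inj, of e d1] d1 eE by (auto simp: B_def)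
  qed
  then have "card {e, d1, d2} = 3" using d1 d2 by auto
  moreover have finB: "finite B" using fin(2) by (simp add: B_def)
  ultimately have B3: "3 \<le> card B" using card_mono[of B "{e, d1, d2}"] eB d1 d2 by auto
  have "B \<subseteq> (\<Union>f\<in>X. bd f \<inter> D)"
  proof
    fix e assume e: "e \<in> B"
    then have "n e \<noteq> 0" by (simp add: B_def)
    then have "{f \<in> X. e \<in> bd f} \<noteq> {}" unfolding n_def by (metis card.empty)
    then show "e \<in> (\<Union>f\<in>X. bd f \<inter> D)" using e BD by blast
  qed
  then have "3 \<le> card (\<Union>f\<in>X. bd f \<inter> D)" using B3 card_mono[of "\<Union>f\<in>X. bd f \<inter> D" B] finX X(1) fin_bd by fastforce
  also have "\<dots> \<le> (\<Sum>f\<in>X. card (bd f \<inter> D))" by (rule card_UN_le[OF finX])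
  finally show ?thesis .
qed

text \<open>For m edges, n vertices and f classes, m + 1 \<le> f + n and 3f \<le> 2m give m \<le> 3n
  - 3, so degrees average below 6. The second inequality holds because each edge lies on two faces
  and each class has at least three boundary incidences.\<close>

lemma edges_in_subset:
  assumes S: "S \<subseteq> V" "S \<noteq> {}" and D: "D = {e \<in> E. ends e \<subseteq> S}"
  shows "card D < 3 * card S"
proof -
  let ?C = "reach_classes F (dual_link (E - D))"
  have DE: "D \<subseteq> E" and finD: "finite D" using D fin by auto
  have finC: "finite ?C" using fin by (simp add: reach_classes_def)
  have cS: "card S > 0" using S fin finite_subset card_gt_0_iff by blast
  have eul: "card D + 1 \<le> card ?C + card S"
    using euler_inequality[OF S(1) DE] D by force
  have sub: "X \<subseteq> F" "X \<noteq> {}" if "X \<in> ?C" for X using that by (auto simp: reach_classes_def)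
  have closed: "g \<in> X" if XC: "X \<in> ?C" and "f \<in> X" "g \<in> F" "d \<in> E - D" "d \<in> bd f" "d \<in> bd g" for X f g d
  proof -
    obtain x where x: "X = {y \<in> F. (x, y) \<in> (dual_link (E - D))\<^sup>*}" using XC unfolding reach_classes_def by blast
    have "(f, g) \<in> dual_link (E - D)" using that sub[OF XC] by (auto simp: dual_link_def)
    then show ?thesis using x that by (auto intro: rtrancl_into_rtrancl)
  qed
  have disj: "X \<inter> Y = {}" if XY: "X \<in> ?C" "Y \<in> ?C" "X \<noteq> Y" for X Y
  proof (rule ccontr)
    assume "X \<inter> Y \<noteq> {}"
    then obtain z where z: "z \<in> X" "z \<in> Y" by blast
    obtain x y where xy: "x \<in> F" "X = {z \<in> F. (x, z) \<in> (dual_link (E - D))\<^sup>*}"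
      "y \<in> F" "Y = {z \<in> F. (y, z) \<in> (dual_link (E - D))\<^sup>*}" using XY(1,2) by (auto simp: reach_classes_def)
    then have "X = {w \<in> F. (z, w) \<in> (dual_link (E - D))\<^sup>*}" "Y = {w \<in> F. (z, w) \<in> (dual_link (E - D))\<^sup>*}"
      using z reach_class_eq_iff[OF sym_links(2)] by auto
    then show False using XY(3) by simp
  qed
  have cover: "\<Union>?C = F" by (auto simp: reach_classes_def)
  show ?thesis
  proof (cases "F \<in> ?C")
    case True
    have "X = F" if "X \<in> ?C" for X using disj[OF that True] sub[OF that] by blast
    then have "?C = {F}" using True by blast
    then have "card ?C = 1" by simp
    then show ?thesis using eul cS by linarith
  next
    case False
    have "3 * card ?C = (\<Sum>X\<in>?C. 3)" by simp
    also have "\<dots> \<le> (\<Sum>X\<in>?C. \<Sum>f\<in>X. card (bd f \<inter> D))"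
    proof (rule sum_mono)
      fix X assume X: "X \<in> ?C"
      show "3 \<le> (\<Sum>f\<in>X. card (bd f \<inter> D))"
        by (rule boundary_ge_3[OF sub[OF X]]) (use False X closed[OF X] in auto)
    qed
    also have "\<dots> = (\<Sum>f\<in>F. card (bd f \<inter> D))"
    proof -
      have "(\<Sum>f\<in>\<Union>?C. card (bd f \<inter> D)) = (\<Sum>X\<in>?C. \<Sum>f\<in>X. card (bd f \<inter> D))"
        using disj finite_subset[OF sub(1) fin(3)] by (subst sum.Union_disjoint) auto
      then show ?thesis unfolding cover by simp
    qed
    also have "\<dots> = (\<Sum>f\<in>F. \<Sum>e\<in>D. if e \<in> bd f then 1 else 0)"
      by (intro sum.cong refl, subst card_filter_sum[OF finD, symmetric], rule arg_cong[where f = card]) auto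
    also have "\<dots> = (\<Sum>e\<in>D. \<Sum>f\<in>F. if e \<in> bd f then 1 else 0)" by (rule sum.swap)
    also have "\<dots> = (\<Sum>e\<in>D. 2)"
    proof (intro sum.cong refl)
      fix e assume "e \<in> D"
      then show "(\<Sum>f\<in>F. if e \<in> bd f then 1 else 0) = (2::nat)"
        using two_faces[of e] card_filter_sum[OF fin(3), of "\<lambda>f. e \<in> bd f"] DE by auto
    qed
    finally have "3 * card ?C \<le> 2 * card D" by simp
    then show ?thesis using eul cS by linarith
  qed
qed

lemma five_degenerate:
  assumes S: "S \<subseteq> V" "S \<noteq> {}"
  shows "\<exists>v\<in>S. card {e \<in> E. ends e \<subseteq> S \<and> v \<in> ends e} \<le> 5"
proof (rule ccontr)
  assume "\<not> ?thesis"
  then have ge: "6 \<le> card {e \<in> E. ends e \<subseteq> S \<and> v \<in> ends e}" if "v \<in> S" for v using that by force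
  have finS: "finite S" using S fin finite_subset by blast
  define D where "D = {e \<in> E. ends e \<subseteq> S}"
  have finD: "finite D" using fin by (simp add: D_def)
  have "6 * card S = (\<Sum>v\<in>S. 6)" by simp
  also have "\<dots> \<le> (\<Sum>v\<in>S. card {e \<in> D. v \<in> ends e})" using ge by (intro sum_mono) (simp add: D_def)
  also have "\<dots> = (\<Sum>v\<in>S. \<Sum>e\<in>D. if v \<in> ends e then 1 else 0)"
    using card_filter_sum[OF finD] by (intro sum.cong refl) simp
  also have "\<dots> = (\<Sum>e\<in>D. \<Sum>v\<in>S. if v \<in> ends e then 1 else 0)" by (rule sum.swap)
  also have "\<dots> = (\<Sum>e\<in>D. 2)"
  proof (intro sum.cong refl)
    fix e assume "e \<in> D"
    then have "S \<inter> ends e = ends e" "card (ends e) = 2" using ends by (auto simp: D_def)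
    then show "(\<Sum>v\<in>S. if v \<in> ends e then 1 else 0) = (2::nat)" using finS by (simp add: sum.If_cases)
  qed
  finally show False using edges_in_subset[OF S D_def] by simp
qed

end

section \<open>Coefficients of graph polynomials\<close>

fun path_edges :: "'a list \<Rightarrow> ('a \<times> 'a) set" where
  "path_edges (x # y # zs) = insert (x, y) (path_edges (y # zs))"
| "path_edges _ = {}"

text \<open>Directing the closing edge from the last entry to the head makes the whole cycle
  directed, so these pairs can themselves serve as a choice of signs.\<close>

definition cycle_edges :: "'a list \<Rightarrow> ('a \<times> 'a) set" where
  "cycle_edges xs = insert (last xs, hd xs) (path_edges xs)"

lemma path_edges_append:
  "path_edges (xs @ ys) = path_edges xs \<union> path_edges ys \<union>
     (if xs \<noteq> [] \<and> ys \<noteq> [] then {(last xs, hd ys)} else {})"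
proof (induction xs rule: path_edges.induct)
  case ("2_2" v)
  then show ?case by (cases ys) auto
qed auto

lemma path_edges_subset: "path_edges xs \<subseteq> set xs \<times> set (tl xs)"
  by (induction xs rule: path_edges.induct) auto

lemma finite_path_edges: "finite (path_edges xs)"
  by (induction xs rule: path_edges.induct) auto

lemma path_edges_asym: "distinct xs \<Longrightarrow> (x, y) \<in> path_edges xs \<Longrightarrow> (y, x) \<notin> path_edges xs"
proof (induction xs rule: path_edges.induct)
  case (1 u v zs)
  then show ?case using path_edges_subset[of "v # zs"] by auto
qed auto

lemma cycle_edges_append: "xs \<noteq> [] \<Longrightarrow> ys \<noteq> [] \<Longrightarrow> cycle_edges (xs @ ys) = cycle_edges (ys @ xs)"
  by (auto simp: cycle_edges_def path_edges_append)

text \<open>On two entries the closing edge would reverse the only path edge, whence the bound on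
  the length.\<close>

lemma cycle_edges_asym:
  assumes "distinct xs" "3 \<le> length xs" "(x, y) \<in> cycle_edges xs"
  shows "(y, x) \<notin> cycle_edges xs"
proof -
  obtain a b xs' where xs: "xs = a # b # xs'" "xs' \<noteq> []"
    using assms(2) by (cases xs; cases "tl xs"; cases "tl (tl xs)") auto
  have "(last xs, hd xs) \<notin> path_edges xs"
    using path_edges_subset[of xs] assms(1) xs by auto
  moreover have "(hd xs, last xs) \<notin> path_edges xs"
    using path_edges_subset[of "b # xs'"] assms(1) xs by auto
  moreover have "hd xs \<noteq> last xs" using assms(1) xs by auto
  ultimately show ?thesis
    using assms(3) path_edges_asym[OF assms(1), of x y] unfolding cycle_edges_def by (metis insert_iff Pair_inject)
qed

section \<open>Coefficients of path and cycle polynomials\<close>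

abbreviation "lookup \<equiv> Poly_Mapping.lookup"
abbreviation "single \<equiv> Poly_Mapping.single"
abbreviation "keys \<equiv> Poly_Mapping.keys"

declare One_nat_def [simp del]

text \<open>The square-free monomial on \<open>A\<close>.\<close>

definition ones :: "'a set \<Rightarrow> ('a \<Rightarrow>\<^sub>0 nat)" where
  "ones A = (\<Sum>v\<in>A. single v 1)"

lemma lookup_ones: "finite A \<Longrightarrow> lookup (ones A) v = (if v \<in> A then 1 else 0)"
  unfolding ones_def by (induction A rule: finite_induct) (auto simp: lookup_add lookup_single when_def)

lemma ones_insert: "finite A \<Longrightarrow> v \<notin> A \<Longrightarrow> ones (insert v A) = ones A + single v 1"
  by (simp add: ones_def add.commute)

lemma ones_remove: "finite A \<Longrightarrow> v \<in> A \<Longrightarrow> ones A - single v 1 = ones (A - {v})"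
  by (rule poly_mapping_eqI) (auto simp: lookup_minus lookup_ones lookup_single)

text \<open>Subtraction of exponents truncates at 0, so monomials without \<open>v\<close> form a
  separate case.\<close>

lemma lookup_times_Var:
  "lookup (p * Var v) m = (if lookup m v = 0 then 0 else lookup p (m - single v 1))"
proof -
  have eq: "m = l + single v 1 \<longleftrightarrow> lookup m v \<noteq> 0 \<and> l = m - single v 1" for l
  proof
    assume "lookup m v \<noteq> 0 \<and> l = m - single v 1"
    then show "m = l + single v 1"
      by (intro poly_mapping_eqI) (auto simp: lookup_minus lookup_add lookup_single when_def)
  qed (auto simp: lookup_add)
  have "lookup (p * Var v) m = (\<Sum>l. lookup p l * (\<Sum>q. lookup (Var v) q when m = l + q))"
    by (rule lookup_mult)
  also have "(\<lambda>l. lookup p l * (\<Sum>q. lookup (Var v) q when m = l + q)) =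
      (\<lambda>l. lookup p l when lookup m v \<noteq> 0 \<and> l = m - single v 1)"
  proof
    fix l
    have "(\<lambda>q. lookup (Var v) q when m = l + q) = (\<lambda>q. (1 when m = l + single v 1) when q = single v 1)"
      by (auto simp: Var_def lookup_single when_def)
    then have "(\<Sum>q. lookup (Var v) q when m = l + q) = (1 when m = l + single v 1)"
      by (simp only: Sum_any_when_equal)
    then show "lookup p l * (\<Sum>q. lookup (Var v) q when m = l + q) =
      (lookup p l when lookup m v \<noteq> 0 \<and> l = m - single v 1)"
      by (simp only: eq) (simp add: when_def)
  qed
  also have "(\<Sum>l. lookup p l when lookup m v \<noteq> 0 \<and> l = m - single v 1) =
      (if lookup m v = 0 then 0 else lookup p (m - single v 1))"
    by simp
  finally show ?thesis .
qed

lemma lookup_times_edge: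
  "lookup (p * (Var u - Var v)) m =
     (if lookup m u = 0 then 0 else lookup p (m - single u 1)) -
     (if lookup m v = 0 then 0 else lookup p (m - single v 1))"
  by (simp add: right_diff_distrib lookup_minus lookup_times_Var)

lemma graph_poly_wrt_insert:
  "finite D \<Longrightarrow> (u, v) \<notin> D \<Longrightarrow> graph_poly_wrt (insert (u, v) D) = graph_poly_wrt D * (Var u - Var v)"
  by (simp add: graph_poly_wrt_def mult.commute)

abbreviation "path_poly xs \<equiv> graph_poly_wrt (path_edges xs)"

lemma path_poly_snoc:
  assumes "xs \<noteq> []" "y \<notin> set xs"
  shows "path_poly (xs @ [y]) = path_poly xs * (Var (last xs) - Var y)"
proof -
  have "path_edges (xs @ [y]) = insert (last xs, y) (path_edges xs)"
    using assms by (simp add: path_edges_append)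
  moreover have "(last xs, y) \<notin> path_edges xs"
    using path_edges_subset[of xs] assms by (auto dest: list.set_sel(2)[rotated])
  ultimately show ?thesis by (simp add: graph_poly_wrt_insert finite_path_edges)
qed

text \<open>The head meets at most one edge of the path. Both bounds serve to show that coefficients
  of unsuitable monomials vanish.\<close>

lemma path_poly_support:
  assumes "distinct xs" "xs \<noteq> []" "lookup (path_poly xs) m \<noteq> 0"
  shows "keys m \<subseteq> set xs \<and> lookup m (hd xs) \<le> 1"
  using assms
proof (induction xs arbitrary: m rule: rev_induct)
  case (snoc y xs)
  show ?case
  proof (cases "xs = []")
    case True
    then have "lookup (1 :: _ rpoly) m \<noteq> 0" using snoc.prems by (simp add: graph_poly_wrt_def)
    then have "m = 0" by (simp add: lookup_one when_def split: if_splits)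
    then show ?thesis by simp
  next
    case False
    define g where "g w = (if lookup m w = 0 then 0 else lookup (path_poly xs) (m - single w 1))" for w
    have "g (last xs) - g y \<noteq> 0"
      using snoc.prems path_poly_snoc[OF False, of y] by (simp add: lookup_times_edge g_def)
    then have "g (last xs) \<noteq> 0 \<or> g y \<noteq> 0" by auto
    then obtain w where "w \<in> {last xs, y}" "g w \<noteq> 0" by blast
    then have w: "w \<in> {last xs, y}" "lookup m w \<noteq> 0" "lookup (path_poly xs) (m - single w 1) \<noteq> 0"
      by (auto simp: g_def split: if_splits)
    have IH: "keys (m - single w 1) \<subseteq> set xs" "lookup (m - single w 1) (hd xs) \<le> 1"
      using snoc w(3) False by auto
    have "v \<in> set (xs @ [y])" if "v \<in> keys m" for v
    proof (cases "v = w")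
      case False
      then have "v \<in> keys (m - single w 1)" using that by (simp add: in_keys_iff lookup_minus lookup_single)
      then show ?thesis using IH by auto
    qed (use w \<open>xs \<noteq> []\<close> in auto)
    moreover have "lookup m (hd xs) \<le> 1"
    proof (cases "w = hd xs")
      \<comment> \<open>The newest edge can contribute the head only if the old path is a single
        vertex.\<close>
      case True
      then have "xs = [w]"
        using w(1) snoc.prems(1) False by (cases xs) (auto split: if_splits)
      then have "path_poly xs = 1" by (simp add: graph_poly_wrt_def)
      then have "m - single w 1 = 0" using w(3) by (simp add: lookup_one when_def split: if_splits)
      then have "lookup (m - single w 1) w = 0" by simp
      then show ?thesis using True by (simp add: lookup_minus)
    next
      case False
      then show ?thesis using IH(2) by (simp add: lookup_minus lookup_single)
    qed
    ultimately show ?thesis using False by auto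
  qed
qed simp

lemma path_poly_coeff_last:
  "distinct (xs @ [z]) \<Longrightarrow> lookup (path_poly (xs @ [z])) (ones (set xs)) = 1"
proof (induction xs arbitrary: z rule: rev_induct)
  case Nil
  then show ?case by (simp add: graph_poly_wrt_def ones_def lookup_one)
next
  case (snoc w xs)
  have "ones (set (xs @ [w])) - single w 1 = ones (set xs)"
    using snoc.prems by (subst ones_remove) auto
  moreover have "z \<notin> set (xs @ [w])" "distinct (xs @ [w])" using snoc.prems by auto
  moreover have "path_poly ((xs @ [w]) @ [z]) = path_poly (xs @ [w]) * (Var w - Var z)"
    using path_poly_snoc[of "xs @ [w]" z] calculation(2) by simp
  ultimately show ?case
    using snoc.IH[of w] by (simp only: lookup_times_edge) (simp add: lookup_ones)
qed

text \<open>A path has one edge fewer than vertices, so omitting \<open>z\<close> forces every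
  choice: edges before \<open>z\<close> give their first end, edges after \<open>z\<close> their
  second end, each of the latter with sign -1.\<close>

lemma path_poly_coeff:
  "distinct (xs @ z # ys) \<Longrightarrow>
    lookup (path_poly (xs @ z # ys)) (ones (set (xs @ ys))) = (-1) ^ length ys"
proof (induction ys rule: rev_induct)
  case Nil
  then show ?case using path_poly_coeff_last[of xs z] by simp
next
  case (snoc y ys)
  let ?p = "xs @ z # ys" and ?m = "ones (set (xs @ ys @ [y]))"
  have d: "distinct ?p" "y \<notin> set ?p" using snoc.prems by auto
  have "?m - single y 1 = ones (set (xs @ ys))" using snoc.prems by (subst ones_remove) auto
  moreover have "lookup ?m y = 1" by (simp add: lookup_ones)
  moreover have "lookup (path_poly ?p) (?m - single (last ?p) 1) = 0"
  proof (rule ccontr)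
    assume "lookup (path_poly ?p) (?m - single (last ?p) 1) \<noteq> 0"
    then have "keys (?m - single (last ?p) 1) \<subseteq> set ?p" using path_poly_support[OF d(1)] by blast
    moreover have "last ?p \<noteq> y" using d(2) last_in_set[of ?p] by fastforce
    then have "y \<in> keys (?m - single (last ?p) 1)" by (simp add: in_keys_iff lookup_minus lookup_ones lookup_single)
    ultimately show False using d(2) by blast
  qed
  ultimately show ?case
    using path_poly_snoc[of ?p y] d snoc.IH by (simp add: lookup_times_edge)
qed

lemma cycle_poly:
  assumes "distinct xs" "2 \<le> length xs"
  shows "graph_poly_wrt (cycle_edges xs) = path_poly xs * (Var (last xs) - Var (hd xs))"
proof -
  have "(last xs, hd xs) \<notin> path_edges xs"
    using path_edges_subset[of xs] assms by (cases xs) auto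
  then show ?thesis by (simp add: cycle_edges_def graph_poly_wrt_insert finite_path_edges)
qed

text \<open>Two choices produce this monomial: all first ends, with sign 1, or all second ends, with
  sign -1 to the power \<open>length xs\<close>. They add up for even length and would cancel for
  odd length.\<close>

lemma even_cycle_coeff:
  assumes "distinct xs" "2 \<le> length xs" "even (length xs)"
  shows "lookup (graph_poly_wrt (cycle_edges xs)) (ones (set xs)) = 2"
proof -
  obtain x ys where xs: "xs = x # ys" "ys \<noteq> []" using assms(2) by (cases xs; cases "tl xs") auto
  obtain ws l where wl: "xs = ws @ [l]" using xs by (metis append_butlast_last_id list.distinct(1))
  have "ones (set xs) - single l 1 = ones (set ws)"
    using assms(1) unfolding wl by (subst ones_remove) auto
  then have 1: "lookup (path_poly xs) (ones (set xs) - single (last xs) 1) = 1"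
    using path_poly_coeff_last[of ws l] assms(1) wl by simp
  have "ones (set xs) - single x 1 = ones (set ys)"
    using assms(1) xs by (subst ones_remove) auto
  moreover have "lookup (path_poly xs) (ones (set ys)) = (-1) ^ length ys"
    using path_poly_coeff[of "[]" x ys] assms(1) xs by simp
  moreover have "odd (length ys)" using assms(3) xs by simp
  ultimately show ?thesis
    using 1 xs cycle_poly[OF assms(1,2)] by (simp add: lookup_times_edge lookup_ones)
qed

text \<open>Taking \<open>x\<close> from the chord leaves the coefficient 2 of the cycle. Taking
  \<open>- y\<close> forces both cycle edges at \<open>x\<close> to give \<open>x\<close>, and the
  path then omits \<open>y\<close>; this adds 1 or -1, so the sum cannot vanish.\<close>

lemma even_cycle_chord_coeff:
  assumes xs: "xs = x # ys @ y # zs" "distinct xs" "even (length xs)" "zs \<noteq> []"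
    and notin: "(x, y) \<notin> cycle_edges xs"
  shows "lookup (graph_poly_wrt (insert (x, y) (cycle_edges xs))) (ones (set xs) + single x 1) \<noteq> 0"
proof -
  have ne: "x \<noteq> y" "last xs \<noteq> x" "last xs \<noteq> y" "last xs \<in> set xs"
    using xs(1,2,4) by (auto dest: arg_cong[of _ _ set] simp: last_in_set)
  let ?m = "ones (set xs) + single x 1"
  let ?m' = "?m - single y 1"
  have l2: "2 \<le> length xs" using xs by simp
  have fin: "finite (cycle_edges xs)" by (simp add: cycle_edges_def finite_path_edges)
  have "?m - single x 1 = ones (set xs)" by simp
  then have 1: "lookup (graph_poly_wrt (cycle_edges xs)) (?m - single x 1) = 2"
    using even_cycle_coeff[OF xs(2) l2 xs(3)] by simp
  \<comment> \<open>If the closing edge gave its other end, the path would need degree 2 at its head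
    \<open>x\<close>.\<close>
  have "lookup (path_poly xs) (?m' - single (last xs) 1) = 0"
  proof (rule ccontr)
    assume "lookup (path_poly xs) (?m' - single (last xs) 1) \<noteq> 0"
    then have "lookup (?m' - single (last xs) 1) x \<le> 1" using path_poly_support[OF xs(2)] xs(1) by fastforce
    then show False using ne xs(1) by (simp add: lookup_minus lookup_add lookup_ones lookup_single)
  qed
  moreover have "?m' - single x 1 = ones (set ((x # ys) @ zs))"
    by (rule poly_mapping_eqI)
      (use xs(1,2) ne(1) in \<open>auto simp: lookup_minus lookup_add lookup_ones lookup_single when_def\<close>)
  then have "lookup (path_poly xs) (?m' - single x 1) = (-1) ^ length zs"
    using path_poly_coeff[of "x # ys" y zs] xs(1,2) by simp
  moreover have "lookup ?m' (last xs) \<noteq> 0" "lookup ?m' x \<noteq> 0"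
    using ne xs(1) by (auto simp: lookup_minus lookup_add lookup_ones lookup_single when_def)
  ultimately have "lookup (graph_poly_wrt (cycle_edges xs)) ?m' = - ((-1) ^ length zs)"
    using xs(1) unfolding cycle_poly[OF xs(2) l2] lookup_times_edge by simp
  moreover have "lookup ?m x \<noteq> 0" "lookup ?m y \<noteq> 0" using xs(1) by (auto simp: lookup_add lookup_ones)
  ultimately have "lookup (graph_poly_wrt (insert (x, y) (cycle_edges xs))) ?m = 2 + (-1) ^ length zs"
    using 1 unfolding graph_poly_wrt_insert[OF fin notin] lookup_times_edge by simp
  also have "\<dots> \<noteq> (0::real)" by (cases "even (length zs)") auto
  finally show ?thesis .
qed

section \<open>Extending a nonzero coefficient vertex by vertex\<close>

text \<open>The sum is the exponent that \<open>v\<close> reaches once the rest of \<open>W\<close>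
  has been added, so the bound already anticipates the final monomial.\<close>

definition extendable :: "'a set \<Rightarrow> ('a \<Rightarrow> 'a \<Rightarrow> bool) \<Rightarrow> nat \<Rightarrow> 'a set \<Rightarrow> bool" where
  "extendable W adj k K \<longleftrightarrow> K \<subseteq> W \<and> (\<exists>D m. sign_choice K adj D \<and> lookup (graph_poly_wrt D) m \<noteq> 0 \<and>
     keys m \<subseteq> K \<and> (\<forall>v\<in>K. lookup m v + card {u \<in> W - K. adj v u} < k))"

lemma lookup_star_poly:
  assumes "finite N" "a \<notin> N" "lookup m a = 0"
  shows "lookup (p * (\<Prod>v\<in>N. Var v - Var a)) (m + ones N) = lookup p m"
  using assms(1,2)
proof (induction N rule: finite_induct)
  case empty
  then show ?case by (simp add: ones_def)
next
  case (insert v N)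
  have "p * (\<Prod>v\<in>insert v N. Var v - Var a) = p * (\<Prod>v\<in>N. Var v - Var a) * (Var v - Var a)"
    using insert by (simp add: mult_ac)
  moreover have "lookup (m + ones (insert v N)) a = 0" "lookup (m + ones (insert v N)) v \<noteq> 0"
    using insert assms(3) by (auto simp: lookup_add lookup_ones)
  moreover have "m + ones (insert v N) - single v 1 = m + ones N"
    using insert by (simp add: ones_insert add.assoc[symmetric])
  ultimately show ?case using insert by (simp only: lookup_times_edge) simp
qed

text \<open>Setting the new variable to 0 turns each new factor into the old endpoint.\<close>

lemma extendable_insert:
  assumes "finite W" and sym: "\<And>x y. adj x y \<Longrightarrow> adj y x" and irrefl: "\<And>x. \<not> adj x x"
    and K: "extendable W adj k K" and a: "a \<in> W - K" "card {u \<in> W - insert a K. adj a u} < k"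
  shows "extendable W adj k (insert a K)"
proof -
  obtain D m where D: "sign_choice K adj D" "lookup (graph_poly_wrt D) m \<noteq> 0" "keys m \<subseteq> K"
    "\<And>v. v \<in> K \<Longrightarrow> lookup m v + card {u \<in> W - K. adj v u} < k" and KW: "K \<subseteq> W"
    using K by (auto simp: extendable_def)
  define N where "N = {v \<in> K. adj v a}"
  have finK: "finite K" using KW assms(1) finite_subset by blast
  then have finN: "finite N" by (simp add: N_def)
  have DK: "D \<subseteq> K \<times> K" using D(1) by (auto simp: sign_choice_def)
  then have finD: "finite D" using finK by (meson finite_SigmaI finite_subset)
  have aN: "a \<notin> N" "lookup m a = 0" using a D(3) by (auto simp: N_def in_keys_iff)
  have "sign_choice (insert a K) adj (D \<union> N \<times> {a})"
  proof -
    have "((u, v) \<in> D \<union> N \<times> {a}) \<noteq> ((v, u) \<in> D \<union> N \<times> {a})"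
      if uv: "u \<in> insert a K" "v \<in> insert a K" "adj u v" for u v
    proof -
      have *: "(p, a) \<notin> D" "(a, p) \<notin> D" for p using DK a(1) by auto
      consider "u = a" "v \<in> K" | "u \<in> K" "v = a" | "u \<in> K" "v \<in> K" using uv irrefl by auto
      then show ?thesis
      proof cases
        case 1
        then show ?thesis using uv(3) sym[of u v] * aN(1) by (auto simp: N_def)
      next
        case 2
        then show ?thesis using uv(3) * aN(1) by (auto simp: N_def)
      next
        case 3
        then have "u \<noteq> a" "v \<noteq> a" using a(1) by auto
        then show ?thesis using D(1) 3 uv(3) by (auto simp: sign_choice_def)
      qed
    qed
    then show ?thesis using D(1) unfolding sign_choice_def by (auto simp: N_def)
  qed
  moreover have "graph_poly_wrt (D \<union> N \<times> {a}) = graph_poly_wrt D * (\<Prod>v\<in>N. Var v - Var a)"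
  proof -
    have "graph_poly_wrt (D \<union> N \<times> {a}) = graph_poly_wrt D * graph_poly_wrt (N \<times> {a})"
      unfolding graph_poly_wrt_def by (rule prod.union_disjoint) (use finD finN DK a(1) in auto)
    moreover have "graph_poly_wrt (N \<times> {a}) = (\<Prod>v\<in>N. Var v - Var a)"
    proof -
      have "N \<times> {a} = (\<lambda>v. (v, a)) ` N" by auto
      then show ?thesis unfolding graph_poly_wrt_def by (simp add: prod.reindex inj_on_def)
    qed
    ultimately show ?thesis by simp
  qed
  then have "lookup (graph_poly_wrt (D \<union> N \<times> {a})) (m + ones N) \<noteq> 0"
    using lookup_star_poly[OF finN aN] D(2) by simp
  moreover have "keys (m + ones N) \<subseteq> insert a K"
  proof
    fix v assume "v \<in> keys (m + ones N)"
    then have "v \<in> keys m \<or> v \<in> N" using finN by (auto simp: in_keys_iff lookup_add lookup_ones)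
    then show "v \<in> insert a K" using D(3) by (auto simp: N_def)
  qed
  \<comment> \<open>For old vertices the sum is preserved: a neighbour of \<open>a\<close> gains
    exponent 1 and loses one later neighbour. The vertex \<open>a\<close> itself starts with
    exponent 0.\<close>
  moreover have "lookup (m + ones N) v + card {u \<in> W - insert a K. adj v u} < k" if "v \<in> insert a K" for v
  proof (cases "v = a")
    case True
    then show ?thesis using a(2) aN finN by (simp add: lookup_add lookup_ones)
  next
    case False
    then have v: "v \<in> K" using that by simp
    have fin: "finite {u \<in> W - insert a K. adj v u}" using assms(1) by simp
    have "{u \<in> W - K. adj v u} = (if adj v a then insert a {u \<in> W - insert a K. adj v u} else {u \<in> W - insert a K. adj v u})"
      using a(1) by auto
    then have "card {u \<in> W - K. adj v u} = card {u \<in> W - insert a K. adj v u} + (if adj v a then 1 else 0)"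
      using fin by simp
    then show ?thesis using D(4)[OF v] v finN by (simp add: lookup_add lookup_ones N_def split: if_splits)
  qed
  ultimately show ?thesis using KW a(1) unfolding extendable_def by blast
qed

text \<open>Whether the coefficient at \<open>m\<close> vanishes does not depend on the choice of
  signs behind \<open>graph_poly\<close>.\<close>

lemma extendable_alon_tarsi:
  assumes "finite W" and sym: "\<And>x y. adj x y \<Longrightarrow> adj y x"
    and "extendable W adj k W"
  shows "alon_tarsi W adj \<le> k"
proof -
  obtain D m where D: "sign_choice W adj D" "lookup (graph_poly_wrt D) m \<noteq> 0" "\<And>v. v \<in> W \<Longrightarrow> lookup m v < k"
    using assms(3) by (auto simp: extendable_def)
  have "sign_choice W adj (SOME D. sign_choice W adj D)" using D(1) by (rule someI)
  then have "graph_poly W adj = graph_poly_wrt D \<or> graph_poly W adj = - graph_poly_wrt D"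
    unfolding graph_poly_def using graph_poly_wrt_unique_up_to_sign[OF assms(1) _ D(1)] sym by blast
  then have "lookup (graph_poly W adj) m \<noteq> 0" using D(2) by auto
  then show ?thesis unfolding alon_tarsi_def using D(3) by (intro Least_le) blast
qed

lemma extendable_cycle:
  assumes xs: "set xs \<subseteq> W" "distinct xs" "even (length xs)" "4 \<le> length xs"
    and edges: "{(x, y). x \<in> set xs \<and> y \<in> set xs \<and> adj x y} = cycle_edges xs \<union> (cycle_edges xs)\<inverse>"
    and out: "\<And>v. v \<in> set xs \<Longrightarrow> card {u \<in> W - set xs. adj v u} + 1 < k"
  shows "extendable W adj k (set xs)"
proof -
  have e: "x \<in> set xs \<and> y \<in> set xs \<and> adj x y \<longleftrightarrow> (x, y) \<in> cycle_edges xs \<or> (y, x) \<in> cycle_edges xs" for x y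
    using edges by (auto simp: set_eq_iff)
  have "sign_choice (set xs) adj (cycle_edges xs)"
    unfolding sign_choice_def using e cycle_edges_asym[OF xs(2)] xs(4) by fastforce
  moreover have "lookup (graph_poly_wrt (cycle_edges xs)) (ones (set xs)) \<noteq> 0"
    using even_cycle_coeff[OF xs(2) _ xs(3)] xs(4) by simp
  moreover have "keys (ones (set xs)) \<subseteq> set xs" by (auto simp: in_keys_iff lookup_ones split: if_splits)
  ultimately show ?thesis using xs(1) out unfolding extendable_def
    by (intro conjI exI[of _ "cycle_edges xs"] exI[of _ "ones (set xs)"]) (auto simp: lookup_ones add.commute)
qed

text \<open>The chord end at the head of the list carries exponent 2, every other cycle vertex
  exponent 1; the two summands in \<open>out\<close> are these exponents.\<close>

lemma extendable_cycle_chord: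
  assumes xs: "set xs \<subseteq> W" "distinct xs" "even (length xs)" "xs = x # ys @ y # zs" "zs \<noteq> []"
    and notin: "(x, y) \<notin> cycle_edges xs" "(y, x) \<notin> cycle_edges xs"
    and edges: "{(x, y). x \<in> set xs \<and> y \<in> set xs \<and> adj x y} =
      insert (x, y) (cycle_edges xs) \<union> (insert (x, y) (cycle_edges xs))\<inverse>"
    and out: "\<And>v. v \<in> set xs \<Longrightarrow> card {u \<in> W - set xs. adj v u} + 1 < k"
      "card {u \<in> W - set xs. adj x u} + 2 < k"
  shows "extendable W adj k (set xs)"
proof -
  let ?D = "insert (x, y) (cycle_edges xs)" and ?m = "ones (set xs) + single x 1"
  have ne: "x \<noteq> y" using xs by auto
  have len: "3 \<le> length xs" using xs by (cases zs) auto
  have e: "u \<in> set xs \<and> v \<in> set xs \<and> adj u v \<longleftrightarrow> (u, v) \<in> ?D \<or> (v, u) \<in> ?D" for u v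
    using edges by (auto simp: set_eq_iff)
  have "(v, u) \<notin> ?D" if "(u, v) \<in> ?D" for u v
    using that cycle_edges_asym[OF xs(2) len] notin ne by auto
  then have "sign_choice (set xs) adj ?D" unfolding sign_choice_def using e by blast
  moreover have "lookup (graph_poly_wrt ?D) ?m \<noteq> 0"
    using even_cycle_chord_coeff[OF xs(4,2,3,5) notin(1)] .
  moreover have "keys ?m \<subseteq> set xs"
    using xs(4) by (auto simp: in_keys_iff lookup_ones lookup_add lookup_single when_def split: if_splits)
  moreover have "lookup ?m v + card {u \<in> W - set xs. adj v u} < k" if "v \<in> set xs" for v
    using out(1)[OF that] out(2) that by (cases "v = x") (auto simp: lookup_add lookup_ones lookup_single)
  ultimately show ?thesis using xs(1) unfolding extendable_def by blast
qed

section \<open>Even cycles in cubic graphs\<close>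

text \<open>Length 2 is excluded because it would traverse a single edge back and forth.\<close>

definition even_cycle :: "('a \<Rightarrow> 'a \<Rightarrow> bool) \<Rightarrow> 'a list \<Rightarrow> bool" where
  "even_cycle adj xs \<longleftrightarrow> distinct xs \<and> successively adj xs \<and> adj (last xs) (hd xs) \<and>
     even (length xs) \<and> 4 \<le> length xs"

lemma successively_path_edges: "successively adj xs \<longleftrightarrow> (\<forall>(x, y)\<in>path_edges xs. adj x y)"
  by (induction xs rule: path_edges.induct) auto

lemma even_cycle_edges: "even_cycle adj xs \<Longrightarrow> (x, y) \<in> cycle_edges xs \<Longrightarrow> adj x y"
  by (auto simp: even_cycle_def cycle_edges_def successively_path_edges)

lemma even_cycle_rotate: "even_cycle adj (xs @ ys) \<Longrightarrow> even_cycle adj (ys @ xs)"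
  by (cases "xs = []"; cases "ys = []")
    (auto simp: even_cycle_def successively_append_iff)

lemma split_two_positions:
  assumes "i < j" "j < length xs"
  shows "xs = take i xs @ xs ! i # take (j - i - 1) (drop (Suc i) xs) @ xs ! j # drop (Suc j) xs"
proof -
  have "drop (Suc i) xs = take (j - i - 1) (drop (Suc i) xs) @ drop j xs"
    using assms append_take_drop_id[of "j - i - 1" "drop (Suc i) xs"] by (simp del: append_take_drop_id)
  moreover have "drop j xs = xs ! j # drop (Suc j) xs" using assms by (simp add: Cons_nth_drop_Suc)
  ultimately show ?thesis using assms id_take_nth_drop[of i xs] by simp
qed

text \<open>All neighbours of the first vertex of a longest path lie on that path. Among three of
  them two have positions of equal parity, and the segment between these closes an even cycle
  through the first vertex.\<close>

lemma even_cycle_exists: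
  assumes fin: "finite A" and A: "A \<noteq> {}"
    and sym: "\<And>x y. adj x y \<Longrightarrow> adj y x" and irrefl: "\<And>x. \<not> adj x x"
    and deg: "\<And>x. x \<in> A \<Longrightarrow> 3 \<le> card {y \<in> A. adj x y}"
  shows "\<exists>xs. set xs \<subseteq> A \<and> even_cycle adj xs"
proof -
  define P where "P xs \<longleftrightarrow> xs \<noteq> [] \<and> distinct xs \<and> set xs \<subseteq> A \<and> successively adj xs" for xs
  obtain a where "a \<in> A" using A by blast
  then have "P [a]" by (simp add: P_def)
  moreover have "\<forall>xs. P xs \<longrightarrow> length xs < Suc (card A)"
    using fin by (metis P_def card_mono distinct_card le_imp_less_Suc)
  ultimately obtain ps where ps: "P ps" "\<And>xs. P xs \<Longrightarrow> length xs \<le> length ps"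
    using ex_has_greatest_nat[of P "[a]" length "Suc (card A)"] by metis
  obtain v qs where vq: "ps = v # qs" using ps(1) by (cases ps) (auto simp: P_def)
  have v: "v \<in> A" using ps(1) vq by (simp add: P_def)
  have nb: "y \<in> set qs" if "y \<in> A" "adj v y" for y
  proof (rule ccontr)
    assume "y \<notin> set qs"
    then have "P (y # ps)" using ps(1) that sym[of v y] irrefl vq by (auto simp: P_def)
    then show False using ps(2) by force
  qed
  define J where "J = {j. j < length qs \<and> adj v (qs ! j)}"
  have finJ: "finite J" by (simp add: J_def)
  have "{y \<in> A. adj v y} \<subseteq> (!) qs ` J" using nb by (auto simp: J_def in_set_conv_nth)
  then have "3 \<le> card J" using deg[OF v] surj_card_le[OF finJ] by (meson le_trans)
  moreover have "card ((\<lambda>j. j mod 2) ` J) \<le> card {0, 1::nat}" by (intro card_mono) auto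
  ultimately have "\<not> inj_on (\<lambda>j. j mod 2) J" using card_image by fastforce
  then obtain i j where "i \<in> J" "j \<in> J" "i \<noteq> j" "i mod 2 = j mod 2" by (auto simp: inj_on_def)
  then obtain i j where ij: "i \<in> J" "j \<in> J" "i < j" "i mod 2 = j mod 2"
    by (metis linorder_neqE_nat)
  define B where "B = take (j - i - 1) (drop (Suc i) qs)"
  have split: "qs = take i qs @ qs ! i # B @ qs ! j # drop (Suc j) qs"
    unfolding B_def by (rule split_two_positions) (use ij in \<open>auto simp: J_def\<close>)
  have len: "length B = j - i - 1" using ij by (auto simp: B_def J_def min_def)
  have "even (j - i)" using ij(3,4) by (simp add: mod_eq_dvd_iff_nat even_diff_nat) presburger
  \<comment> \<open>The three vertices besides \<open>B\<close> are \<open>v\<close>,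
    \<open>qs ! i\<close> and \<open>qs ! j\<close>.\<close>
  then have "even (length B + 3)" "1 \<le> length B" using len ij(3) by presburger+
  moreover have "distinct (v # qs ! i # B @ [qs ! j])"
  proof -
    have "distinct (v # take i qs @ qs ! i # B @ qs ! j # drop (Suc j) qs)"
      using ps(1) vq split by (simp add: P_def)
    then show ?thesis by auto
  qed
  moreover have "successively adj (v # qs ! i # B @ [qs ! j])"
  proof -
    have "successively adj (v # take i qs @ qs ! i # B @ qs ! j # drop (Suc j) qs)"
      using ps(1) vq split by (simp add: P_def)
    then show ?thesis using ij(1) by (auto simp: successively_Cons successively_append_iff J_def hd_append)
  qed
  moreover have "adj (qs ! j) v" using ij(2) sym by (auto simp: J_def)
  moreover have "set (v # qs ! i # B @ [qs ! j]) \<subseteq> A"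
  proof -
    have "set (v # take i qs @ qs ! i # B @ qs ! j # drop (Suc j) qs) \<subseteq> A"
      using ps(1) vq split by (simp add: P_def)
    then show ?thesis by auto
  qed
  ultimately show ?thesis
    by (intro exI[of _ "v # qs ! i # B @ [qs ! j]"]) (auto simp: even_cycle_def)
qed

text \<open>In a shortest even cycle of a cubic graph every chord cuts off odd paths, and two chords
  would give a shorter even cycle, unless all four paths between their ends are single edges.\<close>

locale shortest_even_cycle =
  fixes A :: "'a set" and adj :: "'a \<Rightarrow> 'a \<Rightarrow> bool" and n :: nat
  assumes fin: "finite A"
    and sym: "\<And>x y. adj x y \<Longrightarrow> adj y x" and irrefl: "\<And>x. \<not> adj x x"
    and deg: "\<And>x. x \<in> A \<Longrightarrow> card {y \<in> A. adj x y} \<le> 3"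
    and shortest: "\<And>xs. set xs \<subseteq> A \<Longrightarrow> even_cycle adj xs \<Longrightarrow> n \<le> length xs"
begin

section \<open>Chords of a shortest even cycle\<close>

text \<open>With an even \<open>P\<close> the chord would close an even cycle that avoids
  \<open>Q\<close>. Nonempty \<open>P\<close> and \<open>Q\<close> express that the chord is not an
  edge of the cycle.\<close>

lemma chord_arc_odd:
  assumes "even_cycle adj (x # P @ y # Q)" "set (x # P @ y # Q) \<subseteq> A" "length (x # P @ y # Q) = n"
    and "adj x y" "P \<noteq> []" "Q \<noteq> []"
  shows "odd (length P)"
proof
  assume "even (length P)"
  then have "2 \<le> length P" using assms(5) by (cases P; cases "tl P") auto
  then have "even_cycle adj (x # P @ [y])"
    using assms(1,4,5) \<open>even (length P)\<close> sym[of x y]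
    by (auto simp: even_cycle_def successively_Cons successively_append_iff)
  then have "n \<le> length (x # P @ [y])" using assms(2) by (intro shortest) auto
  then show False using assms(3,6) by (cases Q) auto
qed

text \<open>Following both chords omits \<open>P2\<close> and \<open>Q\<close>. Both chords cut off
  odd paths, so the parities cancel and a shorter even cycle remains.\<close>

lemma no_nested_chord:
  assumes c: "even_cycle adj (x # P1 @ u # P2 @ w # P3 @ y # Q)"
      "set (x # P1 @ u # P2 @ w # P3 @ y # Q) \<subseteq> A" "length (x # P1 @ u # P2 @ w # P3 @ y # Q) = n"
    and "adj x y" "adj u w" "P2 \<noteq> []" "Q \<noteq> []"
  shows False
proof -
  have "odd (length (P1 @ u # P2 @ w # P3))"
    using chord_arc_odd[of x "P1 @ u # P2 @ w # P3" y Q] assms by simp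
  moreover have "odd (length P2)"
  proof (rule chord_arc_odd[of u P2 w "P3 @ y # Q @ x # P1"])
    show "even_cycle adj (u # P2 @ w # P3 @ y # Q @ x # P1)"
      using even_cycle_rotate[of adj "x # P1" "u # P2 @ w # P3 @ y # Q"] c(1) by simp
  qed (use assms in auto)
  ultimately have "even (length (x # P1 @ u # w # P3 @ [y]))" by simp
  moreover have "successively adj (x # P1 @ u # w # P3 @ [y])"
    using c(1) assms(5) unfolding even_cycle_def
    by (cases "P1 = []"; cases "P3 = []") (simp_all add: successively_Cons successively_append_iff)
  moreover have "distinct (x # P1 @ u # w # P3 @ [y])" using c(1) by (auto simp: even_cycle_def)
  ultimately have "even_cycle adj (x # P1 @ u # w # P3 @ [y])"
    using sym[OF assms(4)] by (simp add: even_cycle_def)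
  then have "n \<le> length (x # P1 @ u # w # P3 @ [y])" using c(2) by (intro shortest) auto
  then show False using c(3) assms(6,7) by (cases P2; cases Q) auto
qed

text \<open>The four paths have lengths of equal parity. Hence both cycles that use the two chords
  and one pair of opposite paths are even, of length 4 plus the lengths of that pair. Minimality of
  \<open>n\<close> makes the other pair empty, in either case.\<close>

lemma crossing_chords:
  assumes c: "even_cycle adj (x # P1 @ u # P2 @ y # Q1 @ w # Q2)"
      "set (x # P1 @ u # P2 @ y # Q1 @ w # Q2) \<subseteq> A" "length (x # P1 @ u # P2 @ y # Q1 @ w # Q2) = n"
    and "adj x y" "adj u w"
  shows "P1 = [] \<and> P2 = [] \<and> Q1 = [] \<and> Q2 = []"
proof -
  have 1: "odd (length P1 + length P2 + 1)"
    using chord_arc_odd[of x "P1 @ u # P2" y "Q1 @ w # Q2"] assms by simp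
  have 2: "odd (length P2 + length Q1 + 1)"
  proof -
    have "odd (length (P2 @ y # Q1))"
    proof (rule chord_arc_odd[of u "P2 @ y # Q1" w "Q2 @ x # P1"])
      show "even_cycle adj (u # (P2 @ y # Q1) @ w # Q2 @ x # P1)"
        using even_cycle_rotate[of adj "x # P1" "u # P2 @ y # Q1 @ w # Q2"] c(1) by simp
    qed (use assms in auto)
    then show ?thesis by simp
  qed
  have 3: "even (length P1 + length P2 + length Q1 + length Q2)"
  proof -
    have "even (length (x # P1 @ u # P2 @ y # Q1 @ w # Q2))" using c(1) by (simp only: even_cycle_def)
    then show ?thesis by (simp only: length_append list.size) presburger
  qed
  have sub: "set (x # P1 @ u # w # rev Q1 @ [y]) \<subseteq> A" "set (x # y # rev P2 @ u # w # Q2) \<subseteq> A"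
    using c(2) by auto
  have rev: "successively adj (rev R)" if "successively adj R" for R
    unfolding successively_rev by (rule successively_mono[OF that]) (rule sym)
  have d: "distinct (x # P1 @ u # P2 @ y # Q1 @ w # Q2)"
    and s: "successively adj (x # P1 @ u # P2 @ y # Q1 @ w # Q2)"
    and l: "adj (last (x # P1 @ u # P2 @ y # Q1 @ w # Q2)) x" using c(1) by (auto simp: even_cycle_def)
  have a: "adj y x" "adj w u" using assms(4,5) sym by auto
  have "even (length (x # P1 @ u # w # rev Q1 @ [y]))" using 1 2 3 by (simp only: length_append list.size length_rev) presburger
  moreover have "successively adj (x # P1 @ u # w # rev Q1 @ [y])"
    using s assms(5) rev[of Q1] sym[of y "hd Q1"] sym[of "last Q1" w] sym[of y w]
    by (cases "Q1 = []"; cases "P1 = []")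
      (simp_all add: successively_Cons successively_append_iff hd_rev last_rev del: successively_rev)
  ultimately have "even_cycle adj (x # P1 @ u # w # rev Q1 @ [y])"
    using d a by (auto simp: even_cycle_def)
  then have "n \<le> length (x # P1 @ u # w # rev Q1 @ [y])" using sub by (intro shortest)
  then have "length P2 + length Q2 = 0" using c(3) unfolding length_append list.size length_rev by linarith
  then have PQ2: "P2 = [] \<and> Q2 = []" by simp
  have "even (length (x # y # rev P2 @ u # w # Q2))" using 1 2 3 by (simp only: length_append list.size length_rev) presburger
  moreover have "successively adj (x # y # rev P2 @ u # w # Q2)"
    using s assms(4,5) PQ2 sym[of u y] by (simp add: successively_Cons successively_append_iff)
  moreover have "adj (last (x # y # rev P2 @ u # w # Q2)) x" using l by (auto split: if_splits)
  ultimately have "even_cycle adj (x # y # rev P2 @ u # w # Q2)"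
    using d by (auto simp: even_cycle_def)
  then have "n \<le> length (x # y # rev P2 @ u # w # Q2)" using sub by (intro shortest)
  then have "length P1 + length Q1 = 0" using c(3) unfolding length_append list.size length_rev by linarith
  then show ?thesis using PQ2 by simp
qed

text \<open>The chord and the two cycle edges at \<open>x\<close> exhaust its three neighbours, so
  no second chord ends at \<open>x\<close>.\<close>

lemma cycle_neighbours:
  assumes c: "even_cycle adj (x # P @ y # Q)" "set (x # P @ y # Q) \<subseteq> A" "adj x y" "P \<noteq> []" "Q \<noteq> []"
    and z: "z \<in> A" "adj x z" "z \<noteq> y"
  shows "(x, z) \<in> cycle_edges (x # P @ y # Q) \<or> (z, x) \<in> cycle_edges (x # P @ y # Q)"
proof -
  let ?xs = "x # P @ y # Q"
  have e: "(x, hd P) \<in> cycle_edges ?xs" "(last Q, x) \<in> cycle_edges ?xs"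
    using c(4,5) by (cases P, auto simp: cycle_edges_def)
  have "distinct ?xs" using c(1) by (simp add: even_cycle_def)
  then have "y \<notin> set P" "y \<notin> set Q" "set P \<inter> set Q = {}" by auto
  then have ne: "hd P \<noteq> y" "last Q \<noteq> y" "hd P \<noteq> last Q"
    using hd_in_set[OF c(4)] last_in_set[OF c(5)] by (metis disjoint_iff)+
  have "adj x (hd P)" "adj x (last Q)" using e even_cycle_edges[OF c(1)] sym by auto
  moreover have "hd P \<in> A" "last Q \<in> A" "y \<in> A" "x \<in> A"
    using c(2,4,5) hd_in_set[of P] last_in_set[of Q] by auto
  ultimately have sub: "{hd P, last Q, y} \<subseteq> {y \<in> A. adj x y}" using c(3) by auto
  have "card {hd P, last Q, y} = 3" using ne by auto
  then have eq: "{hd P, last Q, y} = {y \<in> A. adj x y}"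
    using card_seteq[OF _ sub] fin deg[OF \<open>x \<in> A\<close>] by simp
  have "z \<in> {hd P, last Q, y}" unfolding eq using z by simp
  then show ?thesis using z(3) e by auto
qed

text \<open>Rotates the list to begin at an end of the chord, the form used by the other chord
  lemmas.\<close>

lemma chord_rotate:
  assumes c: "even_cycle adj xs" "x \<in> set xs" "y \<in> set xs" "adj x y"
    and notin: "(x, y) \<notin> cycle_edges xs" "(y, x) \<notin> cycle_edges xs"
  obtains P Q where "even_cycle adj (x # P @ y # Q)" "P \<noteq> []" "Q \<noteq> []"
    "cycle_edges (x # P @ y # Q) = cycle_edges xs" "set (x # P @ y # Q) = set xs"
    "length (x # P @ y # Q) = length xs"
proof -
  obtain as bs where ab: "xs = as @ x # bs" using c(2) by (auto simp: in_set_conv_decomp)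
  let ?ys = "x # bs @ as"
  have ce: "cycle_edges ?ys = cycle_edges xs"
    using cycle_edges_append[of as "x # bs"] ab by (cases "as = []") auto
  have ec: "even_cycle adj ?ys" using even_cycle_rotate[of adj as "x # bs"] c(1) ab by simp
  have "y \<noteq> x" using c(4) irrefl by auto
  then have "y \<in> set (bs @ as)" using c(3) ab by auto
  then obtain P Q where PQ: "bs @ as = P @ y # Q" by (meson split_list)
  have "(x, y) \<in> cycle_edges ?ys" if "P = []" using PQ that by (simp add: cycle_edges_def)
  then have "P \<noteq> []" using notin(1) ce by metis
  moreover have "(y, x) \<in> cycle_edges ?ys" if "Q = []" using PQ that by (simp add: cycle_edges_def)
  then have "Q \<noteq> []" using notin(2) ce by metis
  moreover have "set ?ys = set xs" "length ?ys = length xs" using ab by auto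
  ultimately show ?thesis using that[of P Q] ec ce PQ by simp
qed

text \<open>Two chords have distinct ends by \<open>cycle_neighbours\<close>. If \<open>w\<close>
  lies on \<open>P\<close> as well, they are nested, which is impossible; otherwise they
  cross.\<close>

lemma second_chord:
  assumes c: "even_cycle adj (x # P @ y # Q)" "set (x # P @ y # Q) \<subseteq> A" "length (x # P @ y # Q) = n"
    and chord: "adj x y" "P \<noteq> []" "Q \<noteq> []"
    and uw: "u \<in> set P" "w \<in> set (x # P @ y # Q)" "adj u w"
      "(u, w) \<notin> cycle_edges (x # P @ y # Q)" "(w, u) \<notin> cycle_edges (x # P @ y # Q)"
  shows "P = [u] \<and> Q = [w]"
proof -
  let ?xs = "x # P @ y # Q"
  have c': "even_cycle adj (y # Q @ x # P)" "set (y # Q @ x # P) \<subseteq> A"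
    "cycle_edges (y # Q @ x # P) = cycle_edges ?xs"
    using even_cycle_rotate[of adj "x # P" "y # Q"] cycle_edges_append[of "x # P" "y # Q"] c by auto
  have uA: "u \<in> A" using uw c by auto
  have d: "distinct ?xs" using c(1) by (simp add: even_cycle_def)
  have "w \<noteq> x"
  proof
    assume "w = x"
    then have "(x, u) \<in> cycle_edges ?xs \<or> (u, x) \<in> cycle_edges ?xs"
      using cycle_neighbours[OF c(1,2) chord uA] uw(1,3) sym d by auto
    then show False using uw \<open>w = x\<close> by auto
  qed
  moreover have "w \<noteq> y"
  proof
    assume "w = y"
    then have "(y, u) \<in> cycle_edges ?xs \<or> (u, y) \<in> cycle_edges ?xs"
      using cycle_neighbours[OF c'(1,2) sym[OF chord(1)] chord(3,2) uA] c'(3) uw(1,3) sym d by auto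
    then show False using uw \<open>w = y\<close> by auto
  qed
  ultimately consider "w \<in> set P" | "w \<in> set Q" using uw(2) by auto
  then show ?thesis
  proof cases
    case 1
    \<comment> \<open>Renames \<open>u\<close> and \<open>w\<close> according to their order along
      \<open>P\<close>.\<close>
    have "\<exists>P1 a P2 b P3. P = P1 @ a # P2 @ b # P3 \<and> {a, b} = {u, w}"
    proof -
      obtain P1 R where R: "P = P1 @ u # R" using uw(1) by (auto simp: in_set_conv_decomp)
      have "w \<noteq> u" using uw(3) irrefl by auto
      then consider "w \<in> set P1" | "w \<in> set R" using 1 R by auto
      then show ?thesis
      proof cases
        case 1
        then obtain S T where "P1 = S @ w # T" by (auto simp: in_set_conv_decomp)
        then have "P = S @ w # T @ u # R" using R by simp
        then show ?thesis by (metis insert_commute)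
      next
        case 2
        then obtain S T where "R = S @ w # T" by (auto simp: in_set_conv_decomp)
        then have "P = P1 @ u # S @ w # T" using R by simp
        then show ?thesis by blast
      qed
    qed
    then obtain P1 a P2 b P3 where P: "P = P1 @ a # P2 @ b # P3" and ab: "{a, b} = {u, w}" by blast
    have "(a, b) \<notin> cycle_edges ?xs" using ab uw(4,5) by (auto simp: doubleton_eq_iff)
    moreover have "(a, b) \<in> path_edges ((x # P1) @ a # b # P3 @ y # Q)" unfolding path_edges_append by simp
    ultimately have "P2 \<noteq> []" using P by (auto simp: cycle_edges_def)
    moreover have "adj a b" using ab uw(3) sym by (auto simp: doubleton_eq_iff)
    ultimately show ?thesis using no_nested_chord[of x P1 a P2 b P3 y Q] c chord P by simp
  next
    case 2
    obtain P1 P2 where P: "P = P1 @ u # P2" using uw(1) by (auto simp: in_set_conv_decomp)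
    obtain Q1 Q2 where Q: "Q = Q1 @ w # Q2" using 2 by (auto simp: in_set_conv_decomp)
    show ?thesis using crossing_chords[of x P1 u P2 y Q1 w Q2] c chord(1) uw(3) P Q by simp
  qed
qed

lemma shortest_structure:
  assumes c: "even_cycle adj xs" "set xs \<subseteq> A" "length xs = n"
  obtains (induced) "{(x, y). x \<in> set xs \<and> y \<in> set xs \<and> adj x y} = cycle_edges xs \<union> (cycle_edges xs)\<inverse>"
  | (chord) x P y Q where "even_cycle adj (x # P @ y # Q)" "set (x # P @ y # Q) \<subseteq> A" "P \<noteq> []" "Q \<noteq> []" "adj x y"
      "(x, y) \<notin> cycle_edges (x # P @ y # Q)" "(y, x) \<notin> cycle_edges (x # P @ y # Q)"
      "{(u, v). u \<in> set (x # P @ y # Q) \<and> v \<in> set (x # P @ y # Q) \<and> adj u v} =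
        insert (x, y) (cycle_edges (x # P @ y # Q)) \<union> (insert (x, y) (cycle_edges (x # P @ y # Q)))\<inverse>"
  | (K4) x u y w where "distinct [x, u, y, w]" "{x, u, y, w} \<subseteq> A"
      "adj x u" "adj x y" "adj x w" "adj u y" "adj u w" "adj y w"
proof -
  have sub: "(u, v) \<in> cycle_edges ys \<Longrightarrow> u \<in> set ys \<and> v \<in> set ys" if "ys \<noteq> []" for ys :: "'a list" and u v
    using that path_edges_subset[of ys] by (cases ys) (auto simp: cycle_edges_def dest: list.set_sel(2))
  have ne: "xs \<noteq> []" using c by (auto simp: even_cycle_def)
  show ?thesis
  proof (cases "\<exists>x y. x \<in> set xs \<and> y \<in> set xs \<and> adj x y \<and> (x, y) \<notin> cycle_edges xs \<and> (y, x) \<notin> cycle_edges xs")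
    case False
    show ?thesis
      by (rule induced) (use False sub[OF ne] even_cycle_edges[OF c(1)] sym in blast)
  next
    case True
    then obtain x y where xy: "x \<in> set xs" "y \<in> set xs" "adj x y" "(x, y) \<notin> cycle_edges xs" "(y, x) \<notin> cycle_edges xs"
      by blast
    obtain P Q where PQ: "even_cycle adj (x # P @ y # Q)" "P \<noteq> []" "Q \<noteq> []"
      "cycle_edges (x # P @ y # Q) = cycle_edges xs" "set (x # P @ y # Q) = set xs" "length (x # P @ y # Q) = length xs"
      using chord_rotate[OF c(1) xy] .
    let ?ys = "x # P @ y # Q"
    have cy: "set ?ys \<subseteq> A" "length ?ys = n" using PQ c by auto
    show ?thesis
    proof (cases "\<exists>u v. u \<in> set ?ys \<and> v \<in> set ?ys \<and> adj u v \<and> (u, v) \<notin> insert (x, y) (cycle_edges ?ys) \<and>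
        (v, u) \<notin> insert (x, y) (cycle_edges ?ys)")
      case False
      show ?thesis
      proof (rule chord[OF PQ(1) cy(1) PQ(2,3) xy(3)])
        show "{(u, v). u \<in> set ?ys \<and> v \<in> set ?ys \<and> adj u v} =
            insert (x, y) (cycle_edges ?ys) \<union> (insert (x, y) (cycle_edges ?ys))\<inverse>"
          using False sub[of ?ys] even_cycle_edges[OF PQ(1)] sym xy(3) by auto
      qed (use xy PQ in auto)
    next
      case True
      then obtain u v where uv: "u \<in> set ?ys" "v \<in> set ?ys" "adj u v" "(u, v) \<notin> cycle_edges ?ys" "(v, u) \<notin> cycle_edges ?ys"
        "(u, v) \<noteq> (x, y)" "(v, u) \<noteq> (x, y)" by blast
      have c': "even_cycle adj (y # Q @ x # P)" "set (y # Q @ x # P) \<subseteq> A" "length (y # Q @ x # P) = n"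
        "cycle_edges (y # Q @ x # P) = cycle_edges ?ys"
        using even_cycle_rotate[of adj "x # P" "y # Q"] cycle_edges_append[of "x # P" "y # Q"] PQ cy by auto
      have "u \<noteq> x"
        using cycle_neighbours[OF PQ(1) cy(1) xy(3) PQ(2,3), of v] uv cy(1) by auto
      moreover have "u \<noteq> y"
        using cycle_neighbours[OF c'(1,2) sym[OF xy(3)] PQ(3,2), of v] uv cy(1) c'(4) by auto
      ultimately consider "u \<in> set P" | "u \<in> set Q" using uv(1) by auto
      then obtain p q where pq: "P = [p]" "Q = [q]" "adj p q"
      proof cases
        case 1
        then show ?thesis using second_chord[OF PQ(1) cy xy(3) PQ(2,3) 1 uv(2-5)] that uv(3) by auto
      next
        case 2
        have "Q = [u] \<and> P = [v]"
          using second_chord[OF c'(1-3) sym[OF xy(3)] PQ(3,2) 2] uv c'(4) by auto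
        then show ?thesis using that uv(3) sym by auto
      qed
      show ?thesis
      proof (rule K4[of x p y q])
        show "distinct [x, p, y, q]" using PQ(1) pq by (simp add: even_cycle_def)
        show "{x, p, y, q} \<subseteq> A" using cy(1) pq by auto
        have "successively adj [x, p, y, q]" "adj q x" using PQ(1) pq by (auto simp: even_cycle_def)
        then show "adj x p" "adj x y" "adj x q" "adj p y" "adj p q" "adj y q" using pq xy sym by auto
      qed
    qed
  qed
qed

end

lemma cubic_even_cycle:
  assumes fin: "finite A" and A: "A \<noteq> {}"
    and sym: "\<And>x y. adj x y \<Longrightarrow> adj y x" and irrefl: "\<And>x. \<not> adj x x"
    and deg: "\<And>x. x \<in> A \<Longrightarrow> card {y \<in> A. adj x y} = 3"
  obtains (induced) xs where "even_cycle adj xs" "set xs \<subseteq> A"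
      "{(x, y). x \<in> set xs \<and> y \<in> set xs \<and> adj x y} = cycle_edges xs \<union> (cycle_edges xs)\<inverse>"
  | (chord) x P y Q where "even_cycle adj (x # P @ y # Q)" "set (x # P @ y # Q) \<subseteq> A" "P \<noteq> []" "Q \<noteq> []" "adj x y"
      "(x, y) \<notin> cycle_edges (x # P @ y # Q)" "(y, x) \<notin> cycle_edges (x # P @ y # Q)"
      "{(u, v). u \<in> set (x # P @ y # Q) \<and> v \<in> set (x # P @ y # Q) \<and> adj u v} =
        insert (x, y) (cycle_edges (x # P @ y # Q)) \<union> (insert (x, y) (cycle_edges (x # P @ y # Q)))\<inverse>"
  | (K4) x u y w where "distinct [x, u, y, w]" "{x, u, y, w} \<subseteq> A"
      "adj x u" "adj x y" "adj x w" "adj u y" "adj u w" "adj y w"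
proof -
  define C where "C xs \<longleftrightarrow> set xs \<subseteq> A \<and> even_cycle adj xs" for xs
  obtain ys where "C ys"
    using even_cycle_exists[of A adj] fin A sym irrefl deg by (auto simp: C_def)
  then obtain xs where xs: "C xs" "\<And>zs. C zs \<Longrightarrow> length xs \<le> length zs"
    by (metis ex_has_least_nat)
  interpret shortest_even_cycle A adj "length xs"
    by unfold_locales (use fin sym irrefl deg xs(2) in \<open>auto simp: C_def\<close>)
  have "even_cycle adj xs" "set xs \<subseteq> A" using xs(1) by (auto simp: C_def)
  then show ?thesis
    using shortest_structure[of xs thesis] induced[of xs] chord K4 by blast
qed

section \<open>The vertex-face graph\<close>

lemma extendable_grow:
  assumes W: "finite W" "\<And>x y. adj x y \<Longrightarrow> adj y x" "\<And>x. \<not> adj x x"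
    and "extendable W adj k K" "K \<subseteq> T" "T \<subseteq> W"
    and step: "\<And>L. K \<subseteq> L \<Longrightarrow> L \<subset> T \<Longrightarrow> \<exists>a\<in>T - L. card {u \<in> W - insert a L. adj a u} < k"
  shows "extendable W adj k T"
  using assms(4,5,7)
proof (induction "card (T - K)" arbitrary: K rule: less_induct)
  case less
  show ?case
  proof (cases "K = T")
    case False
    then have "K \<subset> T" using less.prems by auto
    then obtain a where a: "a \<in> T - K" "card {u \<in> W - insert a K. adj a u} < k"
      using less.prems(3)[of K] by auto
    have "T - insert a K \<subset> T - K" using a by auto
    then have "card (T - insert a K) < card (T - K)"
      using W(1) assms(6) by (intro psubset_card_mono) (auto intro: finite_subset)
    moreover have "extendable W adj k (insert a K)"
      by (rule extendable_insert[OF W less.prems(1)]) (use a assms(6) in auto)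
    ultimately show ?thesis using less.hyps[of "insert a K"] less.prems(2,3) a by auto
  qed (use less in simp)
qed

lemma even_cycle_degree:
  assumes "even_cycle adj xs" "v \<in> set xs" and sym: "\<And>x y. adj x y \<Longrightarrow> adj y x"
  shows "2 \<le> card {u \<in> set xs. adj v u}"
proof -
  obtain as bs where ab: "xs = as @ v # bs" using assms(2) by (meson split_list)
  have c: "even_cycle adj (v # bs @ as)" using even_cycle_rotate[of adj as "v # bs"] assms(1) ab by simp
  obtain p q R where R: "bs @ as = p # q # R"
    using c by (cases "bs @ as"; cases "tl (bs @ as)") (auto simp: even_cycle_def)
  have "p \<noteq> last (q # R)" using c R last_in_set[of "q # R"] by (auto simp: even_cycle_def simp del: last.simps)
  moreover have "adj v p" "adj v (last (q # R))" using c R sym by (auto simp: even_cycle_def)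
  moreover have "set (bs @ as) \<subseteq> set xs" using ab by auto
  then have "p \<in> set xs" "last (q # R) \<in> set xs" using R last_in_set[of "q # R"] by auto
  ultimately have "{p, last (q # R)} \<subseteq> {u \<in> set xs. adj v u}" "card {p, last (q # R)} = 2" by auto
  then show ?thesis using card_mono[of "{u \<in> set xs. adj v u}" "{p, last (q # R)}"] by simp
qed

lemma cycle_edges_4:
  assumes sym: "\<And>x y. adj x y \<Longrightarrow> adj y x" and irrefl: "\<And>x. \<not> adj x x"
    and "adj a b" "adj b c" "adj c d" "adj d a" "\<not> adj a c" "\<not> adj b d"
  shows "{(p, q). p \<in> set [a, b, c, d] \<and> q \<in> set [a, b, c, d] \<and> adj p q} =
    cycle_edges [a, b, c, d] \<union> (cycle_edges [a, b, c, d])\<inverse>"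
proof -
  have "adj b a" "adj c b" "adj d c" "adj a d" "\<not> adj c a" "\<not> adj d b" using assms sym by blast+
  then show ?thesis using assms(3-) irrefl[of a] irrefl[of b] irrefl[of c] irrefl[of d]
    by (auto simp: cycle_edges_def)
qed

context triangulation
begin

sublocale spherical_triangulation V E F "\<lambda>e. e \<inter> V" bd
proof
  show "finite V" "finite E" "finite F" by (rule finite_V finite_E finite_F)+
  show "e \<inter> V \<subseteq> V \<and> card (e \<inter> V) = 2" if "e \<in> E" for e
    using edge_ends[OF that] by auto
  show "inj_on (\<lambda>e. e \<inter> V) E" using edge_unique by (auto simp: inj_on_def)
  show "bd f \<subseteq> E" for f by (auto simp: bd_def)
  show "even (card {e \<in> bd f. v \<in> e \<inter> V})" if f: "f \<in> F" for f v
  proof -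
    obtain x y z e\<^sub>1 e\<^sub>2 e\<^sub>3 where *: "x \<noteq> y" "y \<noteq> z" "x \<noteq> z"
      "e\<^sub>1 \<inter> V = {x, y}" "e\<^sub>2 \<inter> V = {y, z}" "e\<^sub>3 \<inter> V = {x, z}" "bd f = {e\<^sub>1, e\<^sub>2, e\<^sub>3}"
      using face_cycle[OF f] by metis
    have ne: "e\<^sub>1 \<noteq> e\<^sub>2" "e\<^sub>1 \<noteq> e\<^sub>3" "e\<^sub>2 \<noteq> e\<^sub>3" using * by (auto simp: doubleton_eq_iff)
    have v: "v \<in> e\<^sub>1 \<inter> V \<longleftrightarrow> v = x \<or> v = y" "v \<in> e\<^sub>2 \<inter> V \<longleftrightarrow> v = y \<or> v = z" "v \<in> e\<^sub>3 \<inter> V \<longleftrightarrow> v = x \<or> v = z"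
      unfolding *(4-6) by auto
    consider "v = x" | "v = y" | "v = z" | "v \<notin> {x, y, z}" by auto
    then show ?thesis
    proof cases
      case 1
      then have "{e \<in> bd f. v \<in> e \<inter> V} = {e\<^sub>1, e\<^sub>3}" using v * by blast
      then show ?thesis using ne by simp
    next
      case 2
      then have "{e \<in> bd f. v \<in> e \<inter> V} = {e\<^sub>1, e\<^sub>2}" using v * by blast
      then show ?thesis using ne by simp
    next
      case 3
      then have "{e \<in> bd f. v \<in> e \<inter> V} = {e\<^sub>2, e\<^sub>3}" using v * by blast
      then show ?thesis using ne by simp
    next
      case 4
      then have "{e \<in> bd f. v \<in> e \<inter> V} = {}" using v * by blast
      then show ?thesis by (metis card.empty even_zero)
    qed
  qed
  show "card {f \<in> F. e \<in> bd f} = 2" if "e \<in> E" for e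
    using edge_two_faces[OF that] by (metis card_2_iff)
  show "F \<noteq> {}"
  proof -
    have "V \<noteq> {}" using tri by (simp add: plane_triangulation_def plane_connected_def)
    then show ?thesis using vertex_on_face by blast
  qed
qed (rule dual_connected cycle_separates; assumption)+

section \<open>Neighbours of faces and vertices\<close>

abbreviation "W \<equiv> vf_verts V E"
abbreviation "adj \<equiv> vf_adj V E"

lemma finite_W: "finite W"
  using finite_V finite_F by (simp add: vf_verts_def)

lemma dual_adj: "adj (Inr f) (Inr g) \<longleftrightarrow> f \<noteq> g \<and> bd f \<inter> bd g \<noteq> {}"
  by (auto simp: bd_def)

lemma face_vertices:
  assumes "f \<in> F" "e \<in> bd f" "a \<noteq> b" "e \<inter> V = {a, b}"
  obtains c where "c \<noteq> a" "c \<noteq> b" "frontier f \<inter> V = {a, b, c}"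
proof -
  obtain c e\<^sub>2 e\<^sub>3 where "c \<noteq> a" "c \<noteq> b" "e\<^sub>2 \<inter> V = {a, c}" "e\<^sub>3 \<inter> V = {c, b}" "frontier f = e \<union> (e\<^sub>2 \<union> e\<^sub>3)"
    using face_boundary[OF assms] by metis
  moreover from this have "frontier f \<inter> V = {a, b, c}" using assms(4) by (auto simp: Int_Un_distrib2)
  ultimately show ?thesis using that by blast
qed

lemma card_face_vertices: "f \<in> F \<Longrightarrow> card (frontier f \<inter> V) = 3"
proof -
  assume f: "f \<in> F"
  obtain e where e: "e \<in> bd f" using bd_nonempty[OF f] by blast
  then have "e \<in> E" by (simp add: bd_def)
  then obtain a b where ab: "a \<noteq> b" "e \<inter> V = {a, b}" using edge_cases by blast
  show ?thesis using face_vertices[OF f e ab] ab(1) by (metis card_3_iff)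
qed

text \<open>Each of the three boundary edges has one further face. These faces may coincide, hence
  the inequality.\<close>

lemma card_dual_neighbours:
  assumes "f \<in> F"
  shows "card {g \<in> F. adj (Inr f) (Inr g)} \<le> 3"
proof -
  obtain e\<^sub>1 e\<^sub>2 e\<^sub>3 where bd: "bd f = {e\<^sub>1, e\<^sub>2, e\<^sub>3}" using face_cycle[OF assms] .
  have fin: "finite (bd f)" "card (bd f) \<le> 3" unfolding bd by (simp_all add: card_insert_if)
  have "{g \<in> F. adj (Inr f) (Inr g)} \<subseteq> (\<Union>e\<in>bd f. {h \<in> F. e \<in> bd h} - {f})"
    unfolding dual_adj by auto
  then have "card {g \<in> F. adj (Inr f) (Inr g)} \<le> card (\<Union>e\<in>bd f. {h \<in> F. e \<in> bd h} - {f})"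
    using fin(1) finite_F by (intro card_mono) auto
  also have "\<dots> \<le> (\<Sum>e\<in>bd f. card ({h \<in> F. e \<in> bd h} - {f}))" by (rule card_UN_le[OF fin(1)])
  also have "\<dots> = (\<Sum>e\<in>bd f. 1)"
  proof (intro sum.cong refl)
    fix e assume e: "e \<in> bd f"
    then have "card {h \<in> F. e \<in> bd h} = 2" using two_faces by (simp add: bd_def)
    then show "card ({h \<in> F. e \<in> bd h} - {f}) = 1" using assms e by (simp add: card_Diff_singleton)
  qed
  finally show ?thesis using fin(2) by simp
qed

lemma face_neighbours:
  "{u \<in> W. adj (Inr f) u} = Inl ` (frontier f \<inter> V) \<union> Inr ` {g \<in> F. adj (Inr f) (Inr g)}"
  by (auto simp: vf_verts_def simp del: vf_adj.simps(2))

lemma card_face_neighbours: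
  assumes "f \<in> F"
  shows "card {u \<in> W. adj (Inr f) u} = 3 + card {g \<in> F. adj (Inr f) (Inr g)}"
  unfolding face_neighbours using finite_V finite_F card_face_vertices[OF assms]
  by (subst card_Un_disjoint) (auto simp: card_image)

text \<open>Bookkeeping for a face among placed elements \<open>S\<close>: of its three vertices and
  its dual neighbours, at least \<open>n\<close> are already placed.\<close>

lemma card_outer_neighbours:
  assumes "f \<in> F" "S \<subseteq> W" "n \<le> card {u \<in> S. adj (Inr f) u}"
  shows "card {u \<in> W - S. adj (Inr f) u} + n \<le> 3 + card {g \<in> F. adj (Inr f) (Inr g)}"
proof -
  have "{u \<in> W. adj (Inr f) u} = {u \<in> W - S. adj (Inr f) u} \<union> {u \<in> S. adj (Inr f) u}" using assms(2) by auto
  moreover have "card ({u \<in> W - S. adj (Inr f) u} \<union> {u \<in> S. adj (Inr f) u}) =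
      card {u \<in> W - S. adj (Inr f) u} + card {u \<in> S. adj (Inr f) u}"
    using finite_W finite_subset[OF assms(2) finite_W] by (intro card_Un_disjoint) auto
  ultimately show ?thesis using card_face_neighbours[OF assms(1)] assms(3) by simp
qed

lemma vertex_degenerate:
  assumes "S \<subseteq> V" "S \<noteq> {}"
  obtains v where "v \<in> S" "card {u \<in> S. plane_adj V E v u} \<le> 5"
proof -
  obtain v where v: "v \<in> S" "card {e \<in> E. e \<inter> V \<subseteq> S \<and> v \<in> e \<inter> V} \<le> 5"
    using five_degenerate[OF assms] by blast
  have "{u \<in> S. plane_adj V E v u} \<subseteq> (\<lambda>e. the_elem (e \<inter> V - {v})) ` {e \<in> E. e \<inter> V \<subseteq> S \<and> v \<in> e \<inter> V}"
  proof
    fix u assume "u \<in> {u \<in> S. plane_adj V E v u}"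
    then obtain e where e: "u \<in> S" "u \<noteq> v" "e \<in> E" "e \<inter> V = {v, u}" by (auto simp: plane_adj_def)
    have "e \<inter> V - {v} = {u}" unfolding e(4) using e(2) by auto
    then have "u = the_elem (e \<inter> V - {v})" by simp
    moreover have "e \<inter> V \<subseteq> S" "v \<in> e \<inter> V" unfolding e(4) using e(1) v(1) by auto
    ultimately show "u \<in> (\<lambda>e. the_elem (e \<inter> V - {v})) ` {e \<in> E. e \<inter> V \<subseteq> S \<and> v \<in> e \<inter> V}" using e(3) by blast
  qed
  then have "card {u \<in> S. plane_adj V E v u} \<le> card {e \<in> E. e \<inter> V \<subseteq> S \<and> v \<in> e \<inter> V}"
    using finite_E by (intro surj_card_le) auto
  then show ?thesis using that v by simp
qed

text \<open>A face added next to an earlier one has at most 3 + 3 - 1 = 5 later neighbours. Then the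
  next vertex is always one of degree at most 5 in the subgraph on the vertices still
  missing.\<close>

lemma extend_faces_to_all:
  assumes "extendable W adj 6 K" "K \<subseteq> Inr ` F" "K \<noteq> {}"
  shows "extendable W adj 6 W"
proof -
  note basic = finite_W vf_adj_sym[of V E] vf_adj_irrefl[of V E]
  have faces: "extendable W adj 6 (Inr ` F)"
  proof (rule extendable_grow[OF basic assms(1,2)])
    show "Inr ` F \<subseteq> W" by (auto simp: vf_verts_def)
    fix L assume L: "K \<subseteq> L" "L \<subset> Inr ` F"
    define X where "X = {f \<in> F. Inr f \<in> L}"
    have "X \<subseteq> F" "X \<noteq> {}" "X \<noteq> F" using L assms(2,3) by (auto simp: X_def)
    then obtain f g where fg: "f \<in> X" "g \<in> F" "f \<noteq> g" "bd f \<inter> bd g \<noteq> {}" "g \<notin> X"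
      using dual_connected[of X] by metis
    have "Inr f \<in> insert (Inr g) L" "adj (Inr g) (Inr f)" using fg by (auto simp: X_def bd_def)
    moreover have "finite (insert (Inr g) L)" using L(2) finite_F finite_subset[of L "Inr ` F"] by auto
    ultimately have "{u \<in> insert (Inr g) L. adj (Inr g) u} \<noteq> {}" "finite {u \<in> insert (Inr g) L. adj (Inr g) u}"
      by (blast, simp)
    then have "1 \<le> card {u \<in> insert (Inr g) L. adj (Inr g) u}" by (metis One_nat_def Suc_leI card_gt_0_iff)
    moreover have "insert (Inr g) L \<subseteq> W" using L(2) fg(2) by (auto simp: vf_verts_def)
    ultimately have "card {u \<in> W - insert (Inr g) L. adj (Inr g) u} + 1 \<le> 3 + card {h \<in> F. adj (Inr g) (Inr h)}"
      using card_outer_neighbours[OF fg(2), of "insert (Inr g) L" 1] by simp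
    then have "card {u \<in> W - insert (Inr g) L. adj (Inr g) u} < 6" using card_dual_neighbours[OF fg(2)] by linarith
    moreover have "Inr g \<in> Inr ` F - L" using fg by (auto simp: X_def)
    ultimately show "\<exists>a\<in>Inr ` F - L. card {u \<in> W - insert a L. adj a u} < 6" by blast
  qed
  show ?thesis
  proof (rule extendable_grow[OF basic faces])
    show "Inr ` F \<subseteq> W" "W \<subseteq> W" by (auto simp: vf_verts_def)
    fix L assume L: "Inr ` F \<subseteq> L" "L \<subset> W"
    define S where "S = {v \<in> V. Inl v \<notin> L}"
    have WL: "W - L = Inl ` S" using L by (auto simp: S_def vf_verts_def)
    then have "S \<subseteq> V" "S \<noteq> {}" using L by (auto simp: S_def)
    then obtain v where v: "v \<in> S" "card {u \<in> S. plane_adj V E v u} \<le> 5" using vertex_degenerate by blast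
    have "{u \<in> W - insert (Inl v) L. adj (Inl v) u} \<subseteq> Inl ` {u \<in> S. plane_adj V E v u}"
    proof
      fix z assume z: "z \<in> {u \<in> W - insert (Inl v) L. adj (Inl v) u}"
      then have "z \<in> Inl ` S" unfolding WL[symmetric] by blast
      then obtain u where "z = Inl u" "u \<in> S" by blast
      then show "z \<in> Inl ` {u \<in> S. plane_adj V E v u}" using z by simp
    qed
    then have "card {u \<in> W - insert (Inl v) L. adj (Inl v) u} \<le> card (Inl ` {u \<in> S. plane_adj V E v u} :: (complex + complex set) set)"
      using finite_V by (intro card_mono) (auto simp: S_def)
    also have "\<dots> = card {u \<in> S. plane_adj V E v u}" by (simp add: card_image)
    finally show "\<exists>a\<in>W - L. card {u \<in> W - insert a L. adj a u} < 6"
      using v WL by (intro bexI[of _ "Inl v"]) auto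
  qed
qed

text \<open>If the dual graph is \<open>K\<^sub>4\<close>, then so is the triangulation, and the vertex-face graph has an induced
  4-cycle through two vertices and two faces.\<close>

lemma tetrahedron_extendable:
  assumes F: "F = {f\<^sub>1, f\<^sub>2, f\<^sub>3, f\<^sub>4}" and ne: "distinct [f\<^sub>1, f\<^sub>2, f\<^sub>3, f\<^sub>4]"
    and e: "e \<in> bd f\<^sub>1" "e \<in> bd f\<^sub>2" "e \<inter> V = {x, y}" "x \<noteq> y"
    and e\<^sub>2: "e\<^sub>2 \<in> bd f\<^sub>1" "e\<^sub>2 \<in> bd f\<^sub>3" "e\<^sub>2 \<inter> V = {x, c}" "c \<noteq> x" "c \<noteq> y"
    and e\<^sub>3: "e\<^sub>3 \<in> bd f\<^sub>1" "e\<^sub>3 \<in> bd f\<^sub>4" "e\<^sub>3 \<inter> V = {c, y}"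
    and d: "bd f\<^sub>2 \<inter> bd f\<^sub>3 \<noteq> {}" "bd f\<^sub>2 \<inter> bd f\<^sub>4 \<noteq> {}"
  shows "extendable W adj 6 W"
proof -
  have fF: "f\<^sub>1 \<in> F" "f\<^sub>2 \<in> F" "f\<^sub>3 \<in> F" "f\<^sub>4 \<in> F" using F by auto
  have E: "e \<in> E" "e\<^sub>2 \<in> E" "e\<^sub>3 \<in> E" using e e\<^sub>2 e\<^sub>3 by (auto simp: bd_def)
  have fn: "f\<^sub>1 \<noteq> f\<^sub>2" "f\<^sub>1 \<noteq> f\<^sub>3" "f\<^sub>1 \<noteq> f\<^sub>4" "f\<^sub>2 \<noteq> f\<^sub>3" "f\<^sub>2 \<noteq> f\<^sub>4" "f\<^sub>3 \<noteq> f\<^sub>4" using ne by auto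
  have e_not: "e \<notin> bd f\<^sub>3" "e \<notin> bd f\<^sub>4"
    using no_three_faces[of f\<^sub>1 f\<^sub>2 f\<^sub>3 e] no_three_faces[of f\<^sub>1 f\<^sub>2 f\<^sub>4 e] fF fn e by blast+
  obtain c' d\<^sub>2 d\<^sub>3 where b: "d\<^sub>2 \<in> E" "d\<^sub>3 \<in> E" "c' \<noteq> x" "c' \<noteq> y" "d\<^sub>2 \<inter> V = {x, c'}" "d\<^sub>3 \<inter> V = {c', y}"
    "frontier f\<^sub>2 = e \<union> (d\<^sub>2 \<union> d\<^sub>3)" "bd f\<^sub>2 = {e, d\<^sub>2, d\<^sub>3}"
    using face_boundary[OF fF(2) e(2,4,3)] .
  \<comment> \<open>The edge from \<open>x\<close> to \<open>c\<close> already has the faces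
    \<open>f\<^sub>1\<close> and \<open>f\<^sub>3\<close>, so the third vertex \<open>c'\<close> of
    \<open>f\<^sub>2\<close> is a new one.\<close>
  have "e\<^sub>2 \<notin> bd f\<^sub>2" using no_three_faces[of f\<^sub>1 f\<^sub>2 f\<^sub>3 e\<^sub>2] fF fn e\<^sub>2 by blast
  then have "c \<noteq> c'" using edge_unique[OF E(2) b(1)] b(5,8) e\<^sub>2(3) by auto
  \<comment> \<open>No face holds four vertices. For each of \<open>f\<^sub>3\<close> and
    \<open>f\<^sub>4\<close> this excludes one of the two edges \<open>d\<^sub>2\<close>,
    \<open>d\<^sub>3\<close>, so the edge it shares with \<open>f\<^sub>2\<close> is the other
    one.\<close>
  have card3: "False" if "f \<in> F" "{x, y, c, c'} \<subseteq> frontier f \<inter> V" for f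
  proof -
    have "card {x, y, c, c'} \<le> card (frontier f \<inter> V)" using finite_V that(2) by (intro card_mono) auto
    then show False using card_face_vertices[OF that(1)] \<open>c \<noteq> c'\<close> e(4) e\<^sub>2(4,5) b(3,4) by simp
  qed
  have bdV: "g \<inter> V \<subseteq> frontier f \<inter> V" if "g \<in> bd f" for f g using that by (auto simp: bd_def)
  have v2: "frontier f\<^sub>2 \<inter> V = {x, y, c'}"
  proof -
    have "frontier f\<^sub>2 \<inter> V = e \<inter> V \<union> (d\<^sub>2 \<inter> V \<union> d\<^sub>3 \<inter> V)" using b(7) by blast
    then show ?thesis unfolding e(3) b(5,6) by auto
  qed
  have "d\<^sub>3 \<notin> bd f\<^sub>3" using card3[OF fF(3)] bdV[OF e\<^sub>2(2)] bdV[of d\<^sub>3 f\<^sub>3] e\<^sub>2(3) b(6) by auto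
  then have d2: "d\<^sub>2 \<in> bd f\<^sub>3" using d(1) b(8) e_not by auto
  have "d\<^sub>2 \<notin> bd f\<^sub>4" using card3[OF fF(4)] bdV[OF e\<^sub>3(2)] bdV[of d\<^sub>2 f\<^sub>4] e\<^sub>3(3) b(5) by auto
  then have d3: "d\<^sub>3 \<in> bd f\<^sub>4" using d(2) b(8) e_not by auto
  have cx: "c \<notin> frontier f\<^sub>2" using v2 e\<^sub>2 \<open>c \<noteq> c'\<close> by auto
  have xf4: "x \<notin> frontier f\<^sub>4"
    using card3[OF fF(4)] bdV[OF e\<^sub>3(2)] bdV[OF d3] e\<^sub>3(3) b(6) e(3) by auto
  have V_sub: "V \<subseteq> {x, y, c, c'}"
  proof
    fix v assume v: "v \<in> V"
    obtain f where f: "f \<in> F" "v \<in> frontier f" using vertex_on_face[OF v] .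
    have eq: "frontier h \<inter> V = {p, q, r}"
      if "h \<in> F" "{p, q, r} \<subseteq> frontier h \<inter> V" "p \<noteq> q" "p \<noteq> r" "q \<noteq> r" for h p q r
    proof -
      have "card {p, q, r} = 3" using that(3-5) by simp
      then show ?thesis using card_seteq[OF _ that(2)] finite_V card_face_vertices[OF that(1)] by simp
    qed
    have "frontier f\<^sub>1 \<inter> V = {x, y, c}"
      by (rule eq[OF fF(1)]) (use bdV[OF e(1)] bdV[OF e\<^sub>2(1)] e e\<^sub>2 in auto)
    moreover have "frontier f\<^sub>3 \<inter> V = {x, c, c'}"
      by (rule eq[OF fF(3)]) (use bdV[OF e\<^sub>2(2)] bdV[OF d2] e\<^sub>2 b \<open>c \<noteq> c'\<close> in auto)
    moreover have "frontier f\<^sub>4 \<inter> V = {y, c, c'}"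
      by (rule eq[OF fF(4)]) (use bdV[OF e\<^sub>3(2)] bdV[OF d3] e\<^sub>3 e\<^sub>2 b \<open>c \<noteq> c'\<close> in auto)
    ultimately have "frontier f \<inter> V \<subseteq> {x, y, c, c'}" using f(1) F v2 by auto
    then show "v \<in> {x, y, c, c'}" using f(2) v by blast
  qed
  have xyV: "x \<in> V" "y \<in> V" "c \<in> V" "c' \<in> V" using e(3) e\<^sub>2(3) b(5) by auto
  \<comment> \<open>This cycle has no chord, since \<open>c\<close> is off the boundary of
    \<open>f\<^sub>2\<close> and \<open>x\<close> off that of \<open>f\<^sub>4\<close>. At most four
    elements of \<open>W\<close> remain outside it, so exponent 1 and all later neighbours total at
    most 5.\<close>
  let ?xs = "[Inl c, Inl x, Inr f\<^sub>2, Inr f\<^sub>4] :: (complex + complex set) list"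
  have out: "W - set ?xs \<subseteq> {Inl y, Inl c', Inr f\<^sub>1, Inr f\<^sub>3}"
    using V_sub F by (auto simp: vf_verts_def)
  have cardout: "card (W - set ?xs) \<le> 4"
  proof -
    have "card (W - set ?xs) \<le> card {Inl y, Inl c', Inr f\<^sub>1, Inr f\<^sub>3 :: complex + complex set}"
      by (rule card_mono[OF _ out]) simp
    also have "\<dots> \<le> 4" by (simp add: card_insert_if)
    finally show ?thesis .
  qed
  have ext: "extendable W adj 6 (set ?xs)"
  proof (rule extendable_cycle)
    show "set ?xs \<subseteq> W" using xyV fF by (auto simp: vf_verts_def)
    show "distinct ?xs" using fn e\<^sub>2 by auto
    have a: "adj (Inl c) (Inl x)" "adj (Inl x) (Inr f\<^sub>2)" "adj (Inr f\<^sub>2) (Inr f\<^sub>4)" "adj (Inr f\<^sub>4) (Inl c)"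
      "\<not> adj (Inl c) (Inr f\<^sub>2)" "\<not> adj (Inl x) (Inr f\<^sub>4)"
    proof -
      have "e\<^sub>2 \<inter> V = {c, x}" using e\<^sub>2(3) by (simp add: insert_commute)
      then show "adj (Inl c) (Inl x)" using E(2) e\<^sub>2(4) by (auto simp: plane_adj_def)
      show "adj (Inl x) (Inr f\<^sub>2)" using v2 by auto
      show "adj (Inr f\<^sub>2) (Inr f\<^sub>4)" unfolding dual_adj using d3 b(8) fn(5) by auto
      show "adj (Inr f\<^sub>4) (Inl c)" using bdV[OF e\<^sub>3(2)] e\<^sub>3(3) by auto
      show "\<not> adj (Inl c) (Inr f\<^sub>2)" "\<not> adj (Inl x) (Inr f\<^sub>4)" using cx xf4 by auto
    qed
    show "{(p, q). p \<in> set ?xs \<and> q \<in> set ?xs \<and> adj p q} = cycle_edges ?xs \<union> (cycle_edges ?xs)\<inverse>"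
      by (rule cycle_edges_4[OF vf_adj_sym vf_adj_irrefl a])
    fix v
    have "card {u \<in> W - set ?xs. adj v u} \<le> card (W - set ?xs)" using finite_W by (intro card_mono) auto
    then show "card {u \<in> W - set ?xs. adj v u} + 1 < 6" using cardout by linarith
  qed auto
  show ?thesis
  proof (rule extendable_grow[OF finite_W vf_adj_sym[of V E] vf_adj_irrefl[of V E] ext])
    show "set ?xs \<subseteq> W" "W \<subseteq> W" using xyV fF by (auto simp: vf_verts_def)
    fix L assume L: "set ?xs \<subseteq> L" "L \<subset> W"
    \<comment> \<open>With at most four elements left, any order of insertion works.\<close>
    then obtain a where a: "a \<in> W - L" by auto
    have "card {u \<in> W - insert a L. adj a u} \<le> card (W - set ?xs)"
      using L(1) finite_W by (intro card_mono) auto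
    then show "\<exists>a\<in>W - L. card {u \<in> W - insert a L. adj a u} < 6" using a cardout by (intro bexI[of _ a]) linarith+
  qed
qed

section \<open>Choice of the starting block\<close>

lemma extendable_all: "extendable W adj 6 W"
proof (cases "\<exists>f\<in>F. card {g \<in> F. adj (Inr f) (Inr g)} \<le> 2")
  \<comment> \<open>The block is a single face with the empty product 1: exponent 0 and at most 3 +
    2 later neighbours. A lone triangle falls here, its two faces sharing all three edges.\<close>
  case True
  then obtain f where f: "f \<in> F" "card {g \<in> F. adj (Inr f) (Inr g)} \<le> 2" by blast
  have "card {u \<in> W - {Inr f}. adj (Inr f) u} < 6"
  proof -
    have "{Inr f} \<subseteq> W" using f by (auto simp: vf_verts_def)
    then show ?thesis using card_outer_neighbours[OF f(1), of "{Inr f}" 0] f(2) by simp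
  qed
  moreover have "sign_choice {Inr f} adj {}" using vf_adj_irrefl by (auto simp: sign_choice_def)
  ultimately have "extendable W adj 6 {Inr f}"
    unfolding extendable_def using f(1)
    by (intro conjI exI[of _ "{}"] exI[of _ 0]) (auto simp: graph_poly_wrt_def lookup_one vf_verts_def)
  then show ?thesis by (rule extend_faces_to_all) (use f in auto)
next
  case False
  have deg: "card {g \<in> F. adj (Inr f) (Inr g)} = 3" if "f \<in> F" for f
    using False card_dual_neighbours[OF that] that by force
  have nb: "{y \<in> Inr ` F. adj (Inr f) y} = Inr ` {g \<in> F. adj (Inr f) (Inr g)}" for f
    by (auto simp del: vf_adj.simps)
  have deg': "card {y \<in> Inr ` F. adj x y} = 3" if "x \<in> Inr ` F" for x
    using that deg by (auto simp: nb card_image simp del: vf_adj.simps)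
  have sub: "Inr ` F \<subseteq> W" by (auto simp: vf_verts_def)
  have outer: "card {u \<in> W - set xs. adj v u} + n \<le> 6"
    if xs: "set xs \<subseteq> Inr ` F" "v \<in> set xs" "n \<le> card {u \<in> set xs. adj v u}" for xs v n
  proof -
    obtain f where f: "f \<in> F" "v = Inr f" using xs(1,2) by blast
    have "set xs \<subseteq> W" using xs(1) sub by blast
    then show ?thesis using card_outer_neighbours[OF f(1), of "set xs" n] deg[OF f(1)] xs(3) f(2) by simp
  qed
  show ?thesis
  proof (rule cubic_even_cycle[of "Inr ` F :: (complex + complex set) set" adj])
    show "finite (Inr ` F :: (complex + complex set) set)" "Inr ` F \<noteq> ({} :: (complex + complex set) set)"
      using finite_F F_nonempty by auto
    show "adj p q \<Longrightarrow> adj q p" "\<not> adj p p" for p q by (rule vf_adj_sym, assumption) (rule vf_adj_irrefl)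
    show "card {y \<in> Inr ` F. adj p y} = 3" if "p \<in> Inr ` F" for p using deg'[OF that] .
  next
    fix xs
    assume induced: "even_cycle adj xs" "set xs \<subseteq> Inr ` F"
      "{(p, q). p \<in> set xs \<and> q \<in> set xs \<and> adj p q} = cycle_edges xs \<union> (cycle_edges xs)\<inverse>"
    \<comment> \<open>Of the six neighbours of a face at least two are on the cycle, so exponent 1
      and at most 4 later neighbours give 5.\<close>
    have "extendable W adj 6 (set xs)"
    proof (rule extendable_cycle)
      fix v assume v: "v \<in> set xs"
      have "2 \<le> card {u \<in> set xs. adj v u}" by (rule even_cycle_degree[OF induced(1) v vf_adj_sym])
      then show "card {u \<in> W - set xs. adj v u} + 1 < 6" using outer[OF induced(2) v] by fastforce
    qed (use induced sub in \<open>auto simp: even_cycle_def\<close>)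
    then show ?thesis
      by (rule extend_faces_to_all) (use induced in \<open>auto simp: even_cycle_def\<close>)
  next
    fix x y :: "complex + complex set" and P Q
    let ?xs = "x # P @ y # Q"
    assume chord: "even_cycle adj ?xs" "set ?xs \<subseteq> Inr ` F" "P \<noteq> []" "Q \<noteq> []" "adj x y"
      "(x, y) \<notin> cycle_edges ?xs" "(y, x) \<notin> cycle_edges ?xs"
      "{(u, v). u \<in> set ?xs \<and> v \<in> set ?xs \<and> adj u v} =
        insert (x, y) (cycle_edges ?xs) \<union> (insert (x, y) (cycle_edges ?xs))\<inverse>"
    have deg2: "2 \<le> card {u \<in> set ?xs. adj v u}" if "v \<in> set ?xs" for v
      by (rule even_cycle_degree[OF chord(1) that vf_adj_sym])
    \<comment> \<open>All three dual neighbours of the chord end \<open>x\<close> are on the cycle,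
      which pays for its exponent 2: with its three vertices the total is 5.\<close>
    have deg3: "3 \<le> card {u \<in> set ?xs. adj x u}"
    proof -
      have d: "distinct ?xs" using chord(1) by (simp add: even_cycle_def)
      have "card {hd P, last Q, y} = 3"
      proof -
        have "y \<notin> set P" "y \<notin> set Q" "set P \<inter> set Q = {}" using d by auto
        then have "hd P \<noteq> y" "last Q \<noteq> y" "hd P \<noteq> last Q"
          using hd_in_set[OF chord(3)] last_in_set[OF chord(4)] by (metis disjoint_iff)+
        then show ?thesis by simp
      qed
      moreover have "(x, hd P) \<in> cycle_edges ?xs" "(last Q, x) \<in> cycle_edges ?xs"
        using chord(3,4) by (cases P, auto simp: cycle_edges_def)
      then have "adj x (hd P)" "adj x (last Q)"
        using even_cycle_edges[OF chord(1)] vf_adj_sym by blast+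
      then have "{hd P, last Q, y} \<subseteq> {u \<in> set ?xs. adj x u}"
        using chord(5) hd_in_set[OF chord(3)] last_in_set[OF chord(4)] by auto
      ultimately show ?thesis using card_mono[of "{u \<in> set ?xs. adj x u}" "{hd P, last Q, y}"] by simp
    qed
    have "extendable W adj 6 (set ?xs)"
    proof (rule extendable_cycle_chord[OF _ _ _ refl chord(4,6,7,8)])
      show "set ?xs \<subseteq> W" using chord(2) sub by blast
      show "distinct ?xs" "even (length ?xs)" using chord(1) by (simp_all only: even_cycle_def)
      show "card {u \<in> W - set ?xs. adj v u} + 1 < 6" if "v \<in> set ?xs" for v
        using outer[OF chord(2) that deg2[OF that]] by simp
      show "card {u \<in> W - set ?xs. adj x u} + 2 < 6"
        using outer[OF chord(2) _ deg3] by simp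
    qed
    then show ?thesis by (rule extend_faces_to_all) (use chord(2) in auto)
  next
    fix x u y w
    assume K4: "distinct [x, u, y, w]" "{x, u, y, w} \<subseteq> Inr ` F"
      "adj x u" "adj x y" "adj x w" "adj u y" "adj u w" "adj y w"
    then obtain f1 f2 f3 f4 where f: "x = Inr f1" "u = Inr f2" "y = Inr f3" "w = Inr f4"
      "f1 \<in> F" "f2 \<in> F" "f3 \<in> F" "f4 \<in> F" by auto
    have ne: "distinct [f1, f2, f3, f4]" using K4(1) f by auto
    have bdn: "bd f1 \<inter> bd f2 \<noteq> {}" "bd f1 \<inter> bd f3 \<noteq> {}" "bd f1 \<inter> bd f4 \<noteq> {}" "bd f2 \<inter> bd f3 \<noteq> {}"
      "bd f2 \<inter> bd f4 \<noteq> {}" "bd f3 \<inter> bd f4 \<noteq> {}"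
      using K4(3-) unfolding f dual_adj by auto
    \<comment> \<open>In a cubic dual, four mutually adjacent faces use up one another's neighbours,
      so by dual connectivity there are no other faces.\<close>
    have F: "{f1, f2, f3, f4} = F"
    proof (rule dual_connected)
      fix h g assume hg: "h \<in> {f1, f2, f3, f4}" "g \<in> F" "h \<noteq> g" "bd h \<inter> bd g \<noteq> {}"
      have hF: "h \<in> F" using hg f by auto
      have s: "{f1, f2, f3, f4} - {h} \<subseteq> {g \<in> F. adj (Inr h) (Inr g)}"
        using hg(1) f bdn unfolding dual_adj by auto
      have "card ({f1, f2, f3, f4} - {h}) = 3" using hg(1) ne by (auto simp: card_insert_if insert_Diff_if)
      then have "{f1, f2, f3, f4} - {h} = {g \<in> F. adj (Inr h) (Inr g)}"
        using card_seteq[OF _ s] finite_F deg[OF hF] by simp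
      moreover have "g \<in> {g \<in> F. adj (Inr h) (Inr g)}" using hg unfolding dual_adj by simp
      ultimately show "g \<in> {f1, f2, f3, f4}" by blast
    qed (use f in auto)
    obtain e where e: "e \<in> bd f1" "e \<in> bd f2" using bdn by blast
    then have eE: "e \<in> E" by (simp add: bd_def)
    obtain p q where pq: "p \<noteq> q" "e \<inter> V = {p, q}" using edge_cases[OF eE] .
    obtain c e\<^sub>2 e\<^sub>3 where b: "e\<^sub>2 \<in> E" "e\<^sub>3 \<in> E" "c \<noteq> p" "c \<noteq> q" "e\<^sub>2 \<inter> V = {p, c}" "e\<^sub>3 \<inter> V = {c, q}"
      "frontier f1 = e \<union> (e\<^sub>2 \<union> e\<^sub>3)" "bd f1 = {e, e\<^sub>2, e\<^sub>3}"
      using face_boundary[OF f(5) e(1) pq] .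
    have no3: "\<not> (d \<in> bd f1 \<and> d \<in> bd g \<and> d \<in> bd h)" if "g \<in> F" "h \<in> F" "f1 \<noteq> g" "f1 \<noteq> h" "g \<noteq> h" for d g h
      using no_three_faces[OF f(5) that] by blast
    have fn: "f1 \<noteq> f2" "f1 \<noteq> f3" "f1 \<noteq> f4" "f2 \<noteq> f3" "f2 \<noteq> f4" "f3 \<noteq> f4" using ne by auto
    \<comment> \<open>As \<open>e\<close> belongs to \<open>f1\<close> and \<open>f2\<close>, the
      faces \<open>f3\<close> and \<open>f4\<close> take the other two edges of \<open>f1\<close>,
      one each. The two cases differ by exchanging \<open>f3\<close> and \<open>f4\<close>.\<close>
    have "e \<notin> bd f3" "e \<notin> bd f4"
      using no3[OF f(6,7) fn(1,2,4), of e] no3[OF f(6,8) fn(1,3,5), of e] e by metis+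
    then have "e\<^sub>2 \<in> bd f3 \<or> e\<^sub>3 \<in> bd f3" "e\<^sub>2 \<in> bd f4 \<or> e\<^sub>3 \<in> bd f4" using bdn(2,3) b(8) by auto
    moreover have "e\<^sub>2 \<in> bd f1" "e\<^sub>3 \<in> bd f1" using b(8) by auto
    then have "\<not> (e\<^sub>2 \<in> bd f3 \<and> e\<^sub>2 \<in> bd f4)" "\<not> (e\<^sub>3 \<in> bd f3 \<and> e\<^sub>3 \<in> bd f4)"
      using no3[OF f(7,8) fn(2,3,6)] by metis+
    ultimately consider "e\<^sub>2 \<in> bd f3" "e\<^sub>3 \<in> bd f4" | "e\<^sub>2 \<in> bd f4" "e\<^sub>3 \<in> bd f3" by blast
    then show ?thesis
    proof cases
      case 1
      have "e\<^sub>2 \<in> bd f1" "e\<^sub>3 \<in> bd f1" using b(8) by auto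
      then show ?thesis
        using tetrahedron_extendable[OF F[symmetric] ne e pq(2,1) _ 1(1) b(5,3,4) _ 1(2) b(6) bdn(4,5)] by blast
    next
      case 2
      have "{f1, f2, f3, f4} = {f1, f2, f4, f3}" "distinct [f1, f2, f4, f3]" using fn by auto
      then have "F = {f1, f2, f4, f3}" "distinct [f1, f2, f4, f3]" unfolding F by this
      moreover have "e\<^sub>2 \<in> bd f1" "e\<^sub>3 \<in> bd f1" using b(8) by auto
      ultimately show ?thesis
        using tetrahedron_extendable[OF _ _ e pq(2,1) _ 2(1) b(5,3,4) _ 2(2) b(6) bdn(5,4)] by blast
    qed
  qed
qed

end

theorem theorem3p9:
  fixes V :: "complex set" and E :: "complex set set"
  assumes "plane_triangulation V E"
  shows "alon_tarsi (vf_verts V E) (vf_adj V E) \<le> 6"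
proof -
  interpret triangulation V E using assms by unfold_locales
  show ?thesis
    by (rule extendable_alon_tarsi[OF finite_W vf_adj_sym extendable_all])
qed

end
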